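(* Let $r:\mathbb{R}/2\pi\mathbb{Z}\to\mathbb{R}_{>0}$ be the polar function of the boundary of the square $[-1,1]^2$ (so that $\{(r(\theta)\cos\theta,r(\theta)\sin\theta)\}=\partial[-1,1]^2$). Then there do not exist a continuous $r^*:\mathbb{R}/2\pi\mathbb{Z}\to\mathbb{R}_{>0}$, integers $k,K\ge0$, real numbers $\alpha_i,\beta_j>0$ and complex numbers $A,B,\mu_i,\omega_j$ such that, for all $s\in\mathbb{C}$ (as an identity of meromorphic continuations), $$Z_r(s)=\frac{A^{1-s}\prod_{i=1}^{k}\Gamma(\alpha_i(1-s)+\mu_i)}{B^{s}\prod_{j=1}^{K}\Gamma(\beta_js+\omega_j)}Z_{r^*}(1-s).$$
   Context: For continuous $\rho:\mathbb{R}/2\pi\mathbb{Z}\to\mathbb{R}_{>0}$, the Hlawka zeta function is $Z_\rho(s)=\sum_{(m,n)\in\mathbb{Z}^2\setminus\{0\}}\rho(\theta(m,n))^{2s}(m^2+n^2)^{-s}$ (initially for $\operatorname{Re}(s)>1$), where $\theta(m,n)$ is the angle of $(m,n)$ from the positive $x$-axis. *)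

theory Defs
  imports "HOL-Complex_Analysis.Complex_Analysis"
begin

text \<open>A continuous function from the circle (the reals modulo \<open>2 * pi\<close>) to the positive reals,
  represented by its periodic lift to the real line.\<close>

definition polar_function :: "(real \<Rightarrow> real) \<Rightarrow> bool" where
  "polar_function \<rho> \<longleftrightarrow>
     continuous_on UNIV \<rho> \<and> (\<forall>x. \<rho> (x + 2 * pi) = \<rho> x) \<and> (\<forall>x. \<rho> x > 0)"

text \<open>The series, of interest only for \<open>Re s > 1\<close>, where it converges absolutely. Both powers
  have positive real base. The choice of the range of the angle \<open>Arg\<close> is irrelevant for periodic
  \<open>\<rho>\<close>.\<close>

definition hlawka_zeta :: "(real \<Rightarrow> real) \<Rightarrow> complex \<Rightarrow> complex" where
  "hlawka_zeta \<rho> s =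
     (\<Sum>\<^sub>\<infinity>(m, n) \<in> (UNIV :: (int \<times> int) set) - {(0, 0)}.
        of_real (\<rho> (Arg (Complex (of_int m) (of_int n)))) powr (2 * s)
        * of_int (m\<^sup>2 + n\<^sup>2) powr (- s))"

text \<open>A meromorphic continuation is unique up to its values on a set without
  accumulation points: \<open>meromorphic_on\<close> says nothing about the values at isolated points.\<close>

definition hlawka_continuation :: "(real \<Rightarrow> real) \<Rightarrow> (complex \<Rightarrow> complex) \<Rightarrow> bool" where
  "hlawka_continuation \<rho> F \<longleftrightarrow>
     F meromorphic_on UNIV \<and> (\<forall>s. Re s > 1 \<longrightarrow> F s = hlawka_zeta \<rho> s)"

text \<open>The factor \<open>A^(1-s) \<Prod>\<Gamma>(\<alpha>\<^sub>i(1-s)+\<mu>\<^sub>i) / (B^s \<Prod>\<Gamma>(\<beta>\<^sub>js+\<omega>\<^sub>j))\<close>, with principal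
  powers of \<open>A\<close> and \<open>B\<close>. The library puts \<open>Gamma z = 0\<close> at the poles of \<open>Gamma\<close>; in the
  denominator, \<open>x / 0 = 0\<close> then gives the correct value of the reciprocal. If \<open>A\<close> or \<open>B\<close> is zero,
  then the factor is identically zero.\<close>

definition gamma_factor ::
    "complex \<Rightarrow> complex \<Rightarrow> nat \<Rightarrow> (nat \<Rightarrow> real) \<Rightarrow> (nat \<Rightarrow> complex) \<Rightarrow>
     nat \<Rightarrow> (nat \<Rightarrow> real) \<Rightarrow> (nat \<Rightarrow> complex) \<Rightarrow> complex \<Rightarrow> complex" where
  "gamma_factor A B k \<alpha> \<mu> K \<beta> \<omega> s =
     (A powr (1 - s) * (\<Prod>i=1..k. Gamma (of_real (\<alpha> i) * (1 - s) + \<mu> i)))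
     / (B powr s * (\<Prod>j=1..K. Gamma (of_real (\<beta> j) * s + \<omega> j)))"

end

theory Submission
  imports Defs
begin

text \<open>For the square, \<open>Z\<^sub>r(s) = 8 \<zeta>(2s - 1)\<close>. As \<open>s \<rightarrow> 0\<close> from the left, \<open>Z\<^sub>r(s)\<close> stays bounded
  while \<open>Z\<^bsub>r*\<^esub>(1 - s) \<rightarrow> \<infinity>\<close>, so the gamma factor vanishes at \<open>0\<close>; hence some \<open>\<omega>\<^sub>j\<close> is a pole of
  \<open>\<Gamma>\<close>, and then the gamma factor also vanishes at \<open>s = -m / \<beta>\<^sub>j\<close> for all large \<open>m\<close>. There
  \<open>Z\<^bsub>r*\<^esub>(1 - s)\<close> is bounded, so \<open>\<zeta>\<close> vanishes at \<open>-1 - 2m / \<beta>\<^sub>j\<close>. But the negative zeros of \<open>\<zeta>\<close>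
  are the even integers, i.e. \<open>cos (\<pi> m / \<beta>\<^sub>j) = 0\<close>, which is impossible for \<open>m\<close> and \<open>2m\<close> at once.

  The functional equation of \<open>\<zeta>\<close>, which locates the negative zeros, comes from comparing two
  Mellin transforms: that of \<open>1 / (e\<^sup>t - 1)\<close> expanded as a geometric series (valid for \<open>s > 1\<close>) and
  that of \<open>1 / (e\<^sup>t - 1) - 1 / t + 1 / 2\<close> expanded in partial fractions (valid for \<open>-1 < s < 0\<close>).\<close>

section \<open>Real Mellin transforms\<close>

text \<open>A Bochner integral makes every such statement include absolute convergence, which the
  interchanges and dominations below rely on.\<close>

definition has_mellin :: "(real \<Rightarrow> real) \<Rightarrow> real \<Rightarrow> real \<Rightarrow> bool" where
  "has_mellin f x v \<longleftrightarrow>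
     has_bochner_integral lborel (\<lambda>t. indicat_real {0<..} t * (t powr (x - 1) * f t)) v"

lemma has_mellin_cong:
  assumes "has_mellin f x v" "\<And>t. t > 0 \<Longrightarrow> f t = g t" "v = w"
  shows "has_mellin g x w"
proof -
  have "(\<lambda>t. indicat_real {0<..} t * (t powr (x - 1) * f t)) =
        (\<lambda>t. indicat_real {0<..} t * (t powr (x - 1) * g t))"
    using assms(2) by (auto simp: indicator_def fun_eq_iff)
  with assms show ?thesis by (simp add: has_mellin_def)
qed

lemma has_mellin_add:
  "has_mellin f x v \<Longrightarrow> has_mellin g x w \<Longrightarrow> has_mellin (\<lambda>t. f t + g t) x (v + w)"
  unfolding has_mellin_def
  by (drule (1) has_bochner_integral_add) (simp add: algebra_simps)

lemma has_mellin_cmult: "has_mellin f x v \<Longrightarrow> has_mellin (\<lambda>t. c * f t) x (c * v)"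
  unfolding has_mellin_def
  using has_bochner_integral_mult_right[of c lborel "\<lambda>t. indicat_real {0<..} t * (t powr (x - 1) * f t)" v]
  by (simp add: mult_ac)

lemma has_mellin_scale:
  assumes "has_mellin f x v" "c > 0"
  shows "has_mellin (\<lambda>t. f (c * t)) x (c powr (-x) * v)"
proof -
  have "has_bochner_integral lborel
          (\<lambda>t. indicat_real {0<..} (0 + c * t) * ((0 + c * t) powr (x - 1) * f (0 + c * t))) (v /\<^sub>R \<bar>c\<bar>)"
    using assms(1) assms(2) unfolding has_mellin_def
    by (subst (asm) lborel_has_bochner_integral_real_affine_iff[of c _ _ 0]) auto
  \<comment> \<open>The factor \<open>c powr (1 - x)\<close> turns
    \<open>(c * t) powr (x - 1)\<close> back into \<open>t powr (x - 1)\<close>; with the Jacobian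
    \<open>1 / c\<close> it leaves \<open>c powr (-x)\<close>.\<close>
  from has_bochner_integral_mult_right[OF this, of "c powr (1 - x)"]
  have "has_bochner_integral lborel
          (\<lambda>t. c powr (1 - x) * (indicat_real {0<..} (c * t) * ((c * t) powr (x - 1) * f (c * t))))
          (c powr (1 - x) * (v / c))"
    using assms(2) by (simp add: field_simps)
  also have "(\<lambda>t. c powr (1 - x) * (indicat_real {0<..} (c * t) * ((c * t) powr (x - 1) * f (c * t)))) =
     (\<lambda>t. indicat_real {0<..} t * (t powr (x - 1) * f (c * t)))"
    using assms(2)
    by (auto simp: fun_eq_iff indicator_def powr_mult zero_less_mult_iff simp flip: powr_add)
  also have "c powr (1 - x) * (v / c) = c powr (-x) * v"
    using assms(2) by (simp add: powr_diff powr_minus field_simps)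
  finally show ?thesis unfolding has_mellin_def .
qed

text \<open>For nonnegative terms the integrals of the norms are the \<open>v n\<close> themselves,
  so their summability is already the condition for integrating the series termwise.\<close>

lemma has_mellin_sums:
  assumes "\<And>n. has_mellin (f n) x (v n)" "\<And>n t. t > 0 \<Longrightarrow> f n t \<ge> 0"
    and "\<And>t. t > 0 \<Longrightarrow> (\<lambda>n. f n t) sums g t" "v sums V"
  shows "has_mellin g x V"
proof -
  define F where "F = (\<lambda>n t. indicat_real {0<..} t * (t powr (x - 1) * f n t))"
  have F: "has_bochner_integral lborel (F n) (v n)" for n
    using assms(1)[of n] by (simp add: has_mellin_def F_def)
  have nonneg: "F n t \<ge> 0" for n t using assms(2) by (auto simp: F_def indicator_def)
  have sumsF: "(\<lambda>n. F n t) sums (indicat_real {0<..} t * (t powr (x - 1) * g t))" for t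
    using assms(3)[of t] by (cases "t > 0") (auto simp: F_def intro!: sums_mult)
  have int: "integrable lborel (F n)" "integral\<^sup>L lborel (F n) = v n" for n
    using F[of n] by (simp_all add: has_bochner_integral_iff)
  have *: "AE t in lborel. summable (\<lambda>n. norm (F n t))"
    using sumsF nonneg by (auto simp: sums_iff)
  have **: "summable (\<lambda>n. \<integral>t. norm (F n t) \<partial>lborel)"
    using nonneg int assms(4) by (simp add: sums_iff)
  have "(\<lambda>n. integral\<^sup>L lborel (F n)) sums (\<integral>t. (\<Sum>n. F n t) \<partial>lborel)"
    by (rule sums_integral[OF int(1) * **])
  moreover have "integrable lborel (\<lambda>t. \<Sum>n. F n t)"
    by (rule integrable_suminf[OF int(1) * **])
  moreover have "(\<lambda>t. \<Sum>n. F n t) = (\<lambda>t. indicat_real {0<..} t * (t powr (x - 1) * g t))"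
    using sumsF by (auto simp: sums_iff)
  ultimately show ?thesis using assms(4) int
    by (auto simp: has_mellin_def has_bochner_integral_iff sums_iff)
qed

text \<open>For nonnegative integrands a gauge integral is also a Lebesgue integral; this imports
  the Gamma and Beta integrals.\<close>

lemma has_mellin_has_integral:
  assumes "((\<lambda>t. t powr (x - 1) * f t) has_integral v) {0<..}"
    and "\<And>t. t > 0 \<Longrightarrow> f t \<ge> 0" "f \<in> borel_measurable borel"
  shows "has_mellin f x v"
  unfolding has_mellin_def
proof (rule has_bochner_integral_nn_integral)
  show "v \<ge> 0"
    using assms(1) by (rule has_integral_nonneg) (use assms(2) in auto)
  have "(\<integral>\<^sup>+ t. ennreal (indicat_real {0<..} t * (t powr (x - 1) * f t)) \<partial>lborel) = ennreal v"
    using assms(1) by (intro nn_integral_has_integral_lebesgue) (use assms(2) in auto)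
  thus "(\<integral>\<^sup>+ t. ennreal (indicat_real {0<..} t * (t powr (x - 1) * f t)) \<partial>lborel) = ennreal v" .
qed (use assms(2,3) in \<open>auto simp: indicator_def\<close>)

lemma has_mellin_exp: "x > 0 \<Longrightarrow> has_mellin (\<lambda>t. exp (-t)) x (Gamma x)"
proof (rule has_mellin_has_integral)
  assume "x > 0"
  hence "((\<lambda>t. t powr (x - 1) / exp t) has_integral Gamma x) {0..}"
    by (rule Gamma_integral_real)
  hence "((\<lambda>t. if t \<in> {0<..} then t powr (x - 1) / exp t else 0) has_integral Gamma x) {0..}"
    by (rule has_integral_spike [of "{0}", rotated 2]) auto
  also have "?this \<longleftrightarrow> ((\<lambda>t. t powr (x - 1) / exp t) has_integral Gamma x) {0<..}"
    by (subst has_integral_restrict) auto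
  finally show "((\<lambda>t. t powr (x - 1) * exp (-t)) has_integral Gamma x) {0<..}"
    by (simp add: exp_minus field_simps)
qed auto

text \<open>The substitution \<open>u = t\<^sup>2 / (1 + t\<^sup>2)\<close> turns the integral into
  a Beta integral with parameters (1 + x) / 2 and (1 - x) / 2; these sum to 1, so the reflection
  formula evaluates it.\<close>

lemma has_mellin_rational:
  assumes "-1 < x" "x < 1"
  shows "has_mellin (\<lambda>t. 2 * t / (1 + t\<^sup>2)) x (pi / cos (pi * x / 2))"
proof -
  define p where "p = (x + 1) / 2"
  have p: "p > 0" "1 - p > 0" using assms by (auto simp: p_def field_simps)
  define f where "f = (\<lambda>t::real. t powr (p - 1) * (1 - t) powr ((1 - p) - 1))"
  define g where "g = (\<lambda>t::real. t\<^sup>2 / (1 + t\<^sup>2))"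
  define g' where "g' = (\<lambda>t::real. 2 * t / (1 + t\<^sup>2)\<^sup>2)"
  have nz: "1 + t\<^sup>2 \<noteq> 0" for t :: real by (metis add_pos_nonneg less_irrefl zero_le_power2 zero_less_one)
  have "(f has_integral Beta p (1 - p)) {0..1}"
    unfolding f_def using p by (intro has_integral_Beta_real) auto
  hence "((\<lambda>t. if t \<in> {0<..<1} then f t else 0) has_integral Beta p (1 - p)) {0..1}"
    by (rule has_integral_spike [of "{0,1}", rotated 2]) auto
  hence "(f has_integral Beta p (1 - p)) {0<..<1}"
    by (subst (asm) has_integral_restrict) auto
  hence f: "f absolutely_integrable_on {0<..<1}" "integral {0<..<1} f = Beta p (1 - p)"
    by (auto intro!: nonnegative_absolutely_integrable_1 simp: integral_unique f_def integrable_on_def)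
  have Beta: "Beta p (1 - p) = pi / cos (pi * x / 2)"
  proof -
    have "complex_of_real (Gamma p * Gamma (1 - p)) = Gamma (of_real p) * Gamma (1 - of_real p)"
      using Gamma_complex_of_real[of p] Gamma_complex_of_real[of "1 - p"] by simp
    also have "\<dots> = of_real pi / sin (of_real pi * of_real p)"
      by (rule Gamma_reflection_complex)
    also have "\<dots> = of_real (pi / sin (pi * p))"
      by (simp only: of_real_mult[symmetric] sin_of_real of_real_divide)
    also have "sin (pi * p) = cos (pi * x / 2)"
      by (simp add: p_def sin_add distrib_left add_divide_distrib)
    finally have "Gamma p * Gamma (1 - p) = pi / cos (pi * x / 2)"
      by (simp only: of_real_eq_iff)
    thus ?thesis by (simp add: Beta_def)
  qed
  have img: "g ` {0<..} = {0<..<1}"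
  proof safe
    fix t :: real assume "t \<in> {0<..<1}"
    hence "t = g (sqrt (t / (1 - t)))" "sqrt (t / (1 - t)) \<in> {0<..}"
      by (auto simp: g_def divide_simps)
    thus "t \<in> g ` {0<..}" by blast
  qed (use nz in \<open>auto simp: g_def divide_simps add_pos_nonneg\<close>)
  have inj: "inj_on g {0<..}"
    by (rule inj_onI) (use nz in \<open>auto simp: g_def divide_simps algebra_simps power2_eq_iff\<close>)
  have der: "(g has_field_derivative g' t) (at t within {0<..})" for t
    unfolding g_def g'_def using nz[of t]
    by (auto intro!: derivative_eq_intros simp: divide_simps power2_eq_square) (simp add: algebra_simps)
  have *: "(\<lambda>t. \<bar>g' t\<bar> * f (g t)) absolutely_integrable_on {0<..} \<and>
        integral {0<..} (\<lambda>t. \<bar>g' t\<bar> * f (g t)) = Beta p (1 - p)"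
    using has_absolute_integral_change_of_variables_1'[of "{0<..}" g g' f "Beta p (1 - p)"] der inj f
    by (auto simp: img)
  \<comment> \<open>Since \<open>2 * (p - 1) = x - 1\<close>, the numerator of \<open>g t\<close>
    contributes \<open>t powr (x - 1)\<close>, while the powers of \<open>1 + t\<^sup>2\<close> in
    \<open>f (g t)\<close> combine to exponent 1 and cancel one of the two such factors in
    \<open>g'\<close>.\<close>
  have eq: "\<bar>g' t\<bar> * f (g t) = t powr (x - 1) * (2 * t / (1 + t\<^sup>2))" if "t > 0" for t
  proof -
    have pos: "1 + t\<^sup>2 > 0" using that by (simp add: add_pos_nonneg)
    have "1 - g t = 1 / (1 + t\<^sup>2)" using nz[of t] by (simp add: g_def field_simps)
    hence "f (g t) = (t\<^sup>2 / (1 + t\<^sup>2)) powr (p - 1) * (1 / (1 + t\<^sup>2)) powr (-p)"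
      by (simp add: f_def g_def)
    also have "\<dots> = (t\<^sup>2) powr (p - 1) * ((1 + t\<^sup>2) powr (1 - p) * (1 + t\<^sup>2) powr p)"
      using pos that by (simp add: powr_divide powr_minus powr_diff field_simps)
    also have "(1 + t\<^sup>2) powr (1 - p) * (1 + t\<^sup>2) powr p = 1 + t\<^sup>2"
      using pos by (simp flip: powr_add)
    also have "(t\<^sup>2) powr (p - 1) = t powr (x - 1)"
    proof -
      have "(t\<^sup>2) powr (p - 1) = (t powr 2) powr (p - 1)" using that by (simp add: powr_numeral)
      also have "\<dots> = t powr (2 * (p - 1))" by (rule powr_powr)
      also have "2 * (p - 1) = x - 1" by (simp add: p_def field_simps)
      finally show ?thesis .
    qed
    finally have "\<bar>g' t\<bar> * f (g t) = 2 * t / (1 + t\<^sup>2)\<^sup>2 * (t powr (x - 1) * (1 + t\<^sup>2))"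
      using that by (simp add: g'_def)
    also have "\<dots> = t powr (x - 1) * (2 * t / (1 + t\<^sup>2))"
      unfolding power2_eq_square[of "1 + t\<^sup>2"] using nz[of t] by simp
    finally show ?thesis .
  qed
  have "((\<lambda>t. \<bar>g' t\<bar> * f (g t)) has_integral Beta p (1 - p)) {0<..}"
    using * by (metis has_integral_integral set_lebesgue_integral_eq_integral(1))
  hence "((\<lambda>t. t powr (x - 1) * (2 * t / (1 + t\<^sup>2))) has_integral Beta p (1 - p)) {0<..}"
    by (rule has_integral_eq[rotated]) (use eq in auto)
  thus ?thesis using nz unfolding Beta
    by (intro has_mellin_has_integral) (auto intro!: divide_nonneg_nonneg add_nonneg_nonneg)
qed

section \<open>Partial fractions of the Bose function\<close>

text \<open>Differentiating the reflection formula gives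
  \<open>Digamma z - Digamma (1 - z) = - pi * cot (pi * z)\<close>; the series of
  \<open>Digamma\<close> then supplies the partial fractions.\<close>

lemma cot_partial_fractions:
  fixes z :: complex
  assumes "z \<notin> \<int>"
  shows "(\<lambda>n. 2 * z / (of_nat (Suc n) ^ 2 - z\<^sup>2)) sums (1 / z - of_real pi * cot (of_real pi * z))"
proof -
  have z: "z \<notin> \<int>\<^sub>\<le>\<^sub>0" "1 - z \<notin> \<int>\<^sub>\<le>\<^sub>0" "z \<noteq> 0" "1 - z \<noteq> 0"
    using assms nonpos_Ints_Int Ints_diff[of 1 "1 - z"] by force+
  have z1: "z + 1 \<noteq> 0"
    using assms Ints_1 Ints_minus by (metis eq_neg_iff_add_eq_0)
  have sin: "sin (of_real pi * z) \<noteq> 0"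
  proof
    assume "sin (of_real pi * z) = 0"
    then obtain n where "of_real pi * z = of_real (real_of_int n * pi)" by (auto simp: sin_eq_0)
    hence "z = of_int n" by (simp add: mult.commute)
    with assms show False by simp
  qed
  let ?S = "sin (of_real pi * z)" and ?C = "cos (of_real pi * z)"
  have "((\<lambda>z. Gamma z * Gamma (1 - z)) has_field_derivative
          Gamma z * Gamma (1 - z) * (Digamma z - Digamma (1 - z))) (at z)"
    using z by (auto intro!: derivative_eq_intros simp: algebra_simps)
  moreover have "((\<lambda>z. of_real pi / sin (of_real pi * z)) has_field_derivative
          - (of_real pi * (?C * of_real pi)) / ?S ^ 2) (at z)"
    using sin by (auto intro!: derivative_eq_intros simp: power2_eq_square)
  ultimately have "of_real pi / ?S * (Digamma z - Digamma (1 - z)) = - (of_real pi * (?C * of_real pi)) / ?S ^ 2"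
    using DERIV_unique by (simp only: Gamma_reflection_complex) blast
  hence "?S / of_real pi * (of_real pi / ?S * (Digamma z - Digamma (1 - z))) =
      ?S / of_real pi * (- (of_real pi * (?C * of_real pi)) / ?S ^ 2)"
    by (rule arg_cong)
  hence "Digamma z - Digamma (1 - z) = - of_real pi * cot (of_real pi * z)"
    using sin by (simp add: cot_def power2_eq_square)
  \<comment> \<open>Shifting \<open>z\<close> to \<open>z + 1\<close> makes the two series
    symmetric: their n-th denominators become \<open>Suc n + z\<close> and
    \<open>Suc n - z\<close>.\<close>
  hence refl: "Digamma (z + 1) - Digamma (1 - z) = 1 / z - of_real pi * cot (of_real pi * z)"
    using z Digamma_plus1[of z] by (simp add: algebra_simps)
  have D: "(\<lambda>n. inverse (of_nat (Suc n)) - inverse (w + of_nat n)) sums (Digamma w + euler_mascheroni)"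
    if "w \<noteq> 0" for w :: complex
    using summable_Digamma[OF that] by (simp add: Digamma_def summable_sums)
  have "(\<lambda>n. inverse (1 - z + of_nat n) - inverse (z + 1 + of_nat n)) sums (Digamma (z + 1) - Digamma (1 - z))"
    using sums_diff[OF D[of "z + 1"] D[of "1 - z"]] z z1 by (simp add: add.commute)
  also have "(\<lambda>n. inverse (1 - z + of_nat n) - inverse (z + 1 + of_nat n)) =
      (\<lambda>n. 2 * z / (of_nat (Suc n) ^ 2 - z\<^sup>2))"
  proof
    fix n :: nat
    have "of_nat (Suc n) - z \<noteq> 0" using assms by (metis Ints_of_nat eq_iff_diff_eq_0)
    moreover have "of_nat (Suc n) + z \<noteq> 0"
      using assms by (metis Ints_minus Ints_of_nat add.commute minus_unique)
    moreover have "1 - z + of_nat n = of_nat (Suc n) - z" "z + 1 + of_nat n = of_nat (Suc n) + z" by simp_all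
    moreover have "of_nat (Suc n) ^ 2 - z\<^sup>2 = (of_nat (Suc n) - z) * (of_nat (Suc n) + z)"
      by (simp add: power2_eq_square algebra_simps)
    ultimately show "inverse (1 - z + of_nat n) - inverse (z + 1 + of_nat n) =
        2 * z / (of_nat (Suc n) ^ 2 - z\<^sup>2)"
      by (simp only: ) (simp add: divide_simps del: of_nat_Suc)
  qed
  finally show ?thesis by (simp only: refl)
qed

text \<open>This is the cotangent expansion at the imaginary point
  \<open>\<i> * t / (2 * pi)\<close>, where the cotangent becomes coth(t / 2) = 1 + 2 / (exp t - 1)
  up to a factor \<open>- \<i>\<close>.\<close>

lemma bose_partial_fractions:
  fixes t :: real
  assumes "t > 0"
  shows "(\<lambda>n. 2 * t / (t\<^sup>2 + (2 * pi * real (Suc n))\<^sup>2)) sums (1 / (exp t - 1) - 1 / t + 1 / 2)"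
proof -
  define y where "y = t / (2 * pi)"
  have y: "y > 0" using assms by (simp add: y_def)
  have nI: "\<i> * of_real y \<notin> \<int>" using y by (auto elim!: Ints_cases simp: complex_eq_iff)
  let ?e = "of_real (exp (pi * y)) :: complex"
  have e: "exp (pi * y) > 1" "exp t = exp (pi * y) ^ 2" "t = 2 * pi * y"
    using assms by (auto simp: y_def simp flip: exp_double)
  have "\<i> * (of_real pi * (\<i> * of_real y)) = of_real (- (pi * y))" by (simp add: complex_eq_iff)
  hence iexp: "exp (\<i> * (of_real pi * (\<i> * of_real y))) = 1 / ?e"
    by (simp only: exp_of_real) (simp add: exp_minus divide_inverse)
  have sinh: "sin (of_real pi * (\<i> * of_real y)) = (1 / ?e - ?e) / (2 * \<i>)"
    and cosh: "cos (of_real pi * (\<i> * of_real y)) = (1 / ?e + ?e) / 2"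
    by (simp_all only: sin_exp_eq cos_exp_eq exp_minus iexp) simp_all
  have "1 / (\<i> * of_real y) - of_real pi * cot (of_real pi * (\<i> * of_real y))
        = \<i> * of_real (pi * (exp (pi * y) + 1 / exp (pi * y)) / (exp (pi * y) - 1 / exp (pi * y)) - 1 / y)"
  proof -
    have "(1 / ?e + ?e) / 2 / ((1 / ?e - ?e) / (2 * \<i>)) = - (\<i> * ((?e + 1 / ?e) / (?e - 1 / ?e)))"
    proof -
      \<comment> \<open>The case \<open>D = 0\<close> is consistent because both sides are then 0 by
        the convention for division.\<close>
      have "A / 2 / (- D / (2 * \<i>)) = - (\<i> * (A / D))" for A D :: complex
        by (cases "D = 0") (auto simp: field_simps)
      from this[of "?e + 1 / ?e" "?e - 1 / ?e"] show ?thesis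
        by (simp only: minus_diff_eq add.commute)
    qed
    moreover have "1 / (\<i> * of_real y) = - \<i> / of_real y"
      using y by (simp add: field_simps)
    ultimately show ?thesis
      unfolding cot_def sinh cosh by (simp add: algebra_simps)
  qed
  hence "(\<lambda>n. 2 * (\<i> * of_real y) / (of_nat (Suc n) ^ 2 - (\<i> * of_real y)\<^sup>2)) sums
     (\<i> * of_real (pi * (exp (pi * y) + 1 / exp (pi * y)) / (exp (pi * y) - 1 / exp (pi * y)) - 1 / y))"
    using cot_partial_fractions[OF nI] by simp
  also have "(\<lambda>n. 2 * (\<i> * of_real y) / (of_nat (Suc n) ^ 2 - (\<i> * of_real y)\<^sup>2)) =
     (\<lambda>n. \<i> * of_real (2 * y / (real (Suc n) ^ 2 + y\<^sup>2)))"
    by (simp add: power_mult_distrib mult_ac)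
  \<comment> \<open>All terms are purely imaginary, so imaginary parts give back a real
    series.\<close>
  finally have "(\<lambda>n. Im (\<i> * of_real (2 * y / (real (Suc n) ^ 2 + y\<^sup>2)))) sums
     Im (\<i> * of_real (pi * (exp (pi * y) + 1 / exp (pi * y)) / (exp (pi * y) - 1 / exp (pi * y)) - 1 / y))"
    by (rule sums_Im)
  hence "(\<lambda>n. 2 * y / (real (Suc n) ^ 2 + y\<^sup>2)) sums
      (pi * (exp (pi * y) + 1 / exp (pi * y)) / (exp (pi * y) - 1 / exp (pi * y)) - 1 / y)"
    by simp
  from sums_mult[OF this, of "1 / (2 * pi)"]
  have *: "(\<lambda>n. 1 / (2 * pi) * (2 * y / (real (Suc n) ^ 2 + y\<^sup>2))) sums
    (1 / (2 * pi) * (pi * (exp (pi * y) + 1 / exp (pi * y)) / (exp (pi * y) - 1 / exp (pi * y)) - 1 / y))" .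
  have "1 / (2 * pi) * (2 * y / (real (Suc n) ^ 2 + y\<^sup>2)) = 2 * t / (t\<^sup>2 + (2 * pi * real (Suc n))\<^sup>2)" for n
  proof -
    have "t\<^sup>2 + (2 * pi * real (Suc n))\<^sup>2 = (2 * pi)\<^sup>2 * (real (Suc n) ^ 2 + y\<^sup>2)"
      using e by (simp add: power2_eq_square algebra_simps)
    moreover have "real (Suc n) ^ 2 + y\<^sup>2 \<noteq> 0" using y by (simp add: add_pos_pos less_imp_neq[symmetric] del: of_nat_Suc)
    ultimately show ?thesis by (simp only: e(3)) (simp add: power2_eq_square)
  qed
  moreover have "1 / (2 * pi) * (pi * (exp (pi * y) + 1 / exp (pi * y)) / (exp (pi * y) - 1 / exp (pi * y)) - 1 / y)
      = 1 / (exp t - 1) - 1 / t + 1 / 2"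
  proof -
    \<comment> \<open>\<open>E\<close> is \<open>exp (t / 2)\<close>, so that
      \<open>E * E = exp t\<close>.\<close>
    define E where "E = exp (pi * y)"
    have E: "E > 1" "E * E > 1" using e less_1_mult unfolding E_def by blast+
    have "pi * (E + 1 / E) / (E - 1 / E) = pi * (E * E + 1) / (E * E - 1)"
      using E by (simp add: divide_simps)
    moreover have "1 / (2 * pi) * (pi * (E * E + 1) / (E * E - 1) - 1 / y) = 1 / (E * E - 1) - 1 / (2 * pi * y) + 1 / 2"
      using E y by (simp add: divide_simps) (simp add: algebra_simps)
    ultimately show ?thesis using e by (simp add: E_def power2_eq_square)
  qed
  ultimately show ?thesis using * by simp
qed

section \<open>Holomorphy of Laplace transforms\<close>

text \<open>The exponential is expanded in powers of \<open>s - s0\<close> and integrated termwise,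
  which yields a power series on a disc. As \<open>u\<close> may have either sign, the dominating
  function \<open>D\<close> uses the integrand at a real point on each side of
  \<open>Re s0\<close>.\<close>

lemma holomorphic_laplace:
  fixes u k :: "'a \<Rightarrow> real"
  assumes int: "\<And>x. a < x \<Longrightarrow> integrable M (\<lambda>t. exp (x * u t) * k t)"
    and [measurable]: "u \<in> borel_measurable M" "k \<in> borel_measurable M"
  shows "(\<lambda>s. \<integral>t. exp (s * of_real (u t)) * of_real (k t) \<partial>M) holomorphic_on {s. Re s > a}"
    (is "?I holomorphic_on _")
proof -
  have "?I field_differentiable at s0" if s0: "Re s0 > a" for s0
  proof -
    \<comment> \<open>Half the distance to the boundary line, which keeps \<open>Re s0 - d\<close>
      and \<open>Re s0 + d\<close> in the range of integrability.\<close>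
    define d where "d = (Re s0 - a) / 2"
    have d: "d > 0" "a < Re s0 - d" "a < Re s0 + d" using s0 by (auto simp: d_def field_simps)
    define c where "c = (\<lambda>n t. exp (s0 * of_real (u t)) * of_real (k t) * (of_real (u t) ^ n / fact n))"
    define D where "D = (\<lambda>t. \<bar>exp ((Re s0 + d) * u t) * k t\<bar> + \<bar>exp ((Re s0 - d) * u t) * k t\<bar>)"
    have D: "integrable M D" unfolding D_def using int d by auto
    have norm_c: "norm (c n t) = exp (Re s0 * u t) * \<bar>k t\<bar> * (\<bar>u t\<bar> ^ n / fact n)" for n t
      by (simp add: c_def norm_mult norm_divide norm_power)
    have partial: "(\<Sum>i<n. norm (c i t) * e ^ i) \<le> D t" if e: "0 \<le> e" "e \<le> d" for n t e
    proof -
      have "(\<Sum>i<n. (\<bar>u t\<bar> * e) ^ i / fact i) \<le> exp (\<bar>u t\<bar> * e)"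
        using sum_le_suminf[of "\<lambda>i. (\<bar>u t\<bar> * e) ^ i /\<^sub>R fact i" "{..<n}"]
          summable_exp[of "e * \<bar>u t\<bar>"] e
        by (simp add: exp_def summable_exp_generic divide_inverse mult.commute)
      also have "\<dots> \<le> exp (\<bar>u t\<bar> * d)" using e by (simp add: mult_left_mono)
      also have "\<dots> \<le> exp (d * u t) + exp (- (d * u t))" by (simp add: abs_if mult.commute)
      finally have "exp (Re s0 * u t) * \<bar>k t\<bar> * (\<Sum>i<n. (\<bar>u t\<bar> * e) ^ i / fact i) \<le>
           exp (Re s0 * u t) * \<bar>k t\<bar> * (exp (d * u t) + exp (- (d * u t)))"
        by (intro mult_left_mono) auto
      also have "\<dots> = D t"
        by (simp add: D_def abs_mult algebra_simps flip: exp_add mult.assoc)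
      finally show ?thesis
        by (simp add: norm_c sum_distrib_left power_mult_distrib mult_ac)
    qed
    have summ: "summable (\<lambda>i. norm (c i t) * e ^ i)" if e: "0 \<le> e" "e \<le> d" for t e
      by (rule summableI_nonneg_bounded) (use partial[OF e] e in auto)
    have int_c: "integrable M (c n)" for n
    proof (rule Bochner_Integration.integrable_bound)
      show "integrable M (\<lambda>t. D t / d ^ n)" using D by simp
      show "c n \<in> borel_measurable M" unfolding c_def by measurable
      have "norm (c n t) \<le> D t / d ^ n" for t
      proof -
        \<comment> \<open>A single coefficient is bounded by a partial sum at the full radius
          \<open>d\<close>, hence by \<open>D t\<close>.\<close>
        have "norm (c n t) * d ^ n \<le> (\<Sum>i<Suc n. norm (c i t) * d ^ i)"
          using d by (intro member_le_sum) auto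
        also have "\<dots> \<le> D t" using partial[of d t "Suc n"] d by simp
        finally show ?thesis using d by (simp add: field_simps)
      qed
      thus "AE t in M. norm (c n t) \<le> norm (D t / d ^ n)"
        unfolding real_norm_def by (intro AE_I2 order_trans[OF _ abs_ge_self]) simp
    qed
    have "(\<lambda>n. (\<integral>t. c n t \<partial>M) * (s - s0) ^ n) sums ?I s" if s: "s \<in> ball s0 d" for s
    proof -
      have e: "0 \<le> norm (s - s0)" "norm (s - s0) \<le> d" using s by (auto simp: dist_norm norm_minus_commute)
      define f where "f = (\<lambda>n t. c n t * (s - s0) ^ n)"
      have nf: "norm (f n t) = norm (c n t) * norm (s - s0) ^ n" for n t
        by (simp add: f_def norm_mult norm_power)
      have int_f: "integrable M (f n)" for n using int_c by (simp add: f_def)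
      have AE: "AE t in M. summable (\<lambda>n. norm (f n t))" using summ[OF e] by (simp add: nf)
      have sm: "summable (\<lambda>n. \<integral>t. norm (f n t) \<partial>M)"
      proof (rule summableI_nonneg_bounded)
        fix n
        have "(\<Sum>i<n. \<integral>t. norm (f i t) \<partial>M) = (\<integral>t. (\<Sum>i<n. norm (f i t)) \<partial>M)"
          using int_f by (simp add: Bochner_Integration.integral_sum)
        also have "\<dots> \<le> (\<integral>t. D t \<partial>M)"
        proof (rule integral_mono[OF _ D])
          show "integrable M (\<lambda>t. \<Sum>i<n. norm (f i t))"
            by (intro Bochner_Integration.integrable_sum integrable_norm int_f)
        qed (use partial[OF e] in \<open>simp add: nf\<close>)
        finally show "(\<Sum>i<n. \<integral>t. norm (f i t) \<partial>M) \<le> (\<integral>t. D t \<partial>M)" .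
      qed auto
      have "(\<lambda>n. \<integral>t. f n t \<partial>M) sums (\<integral>t. (\<Sum>n. f n t) \<partial>M)"
        by (rule sums_integral[OF int_f AE sm])
      moreover have "(\<Sum>n. f n t) = exp (s * of_real (u t)) * of_real (k t)" for t
      proof -
        have "(\<lambda>n. ((s - s0) * of_real (u t)) ^ n /\<^sub>R fact n) sums exp ((s - s0) * of_real (u t))"
          by (rule exp_converges)
        from sums_mult[OF this, of "exp (s0 * of_real (u t)) * of_real (k t)"]
        have "(\<lambda>n. f n t) sums (exp (s0 * of_real (u t)) * of_real (k t) * exp ((s - s0) * of_real (u t)))"
          by (simp add: f_def c_def power_mult_distrib scaleR_conv_of_real divide_inverse mult_ac)
        also have "exp (s0 * of_real (u t)) * of_real (k t) * exp ((s - s0) * of_real (u t)) =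
            exp (s * of_real (u t)) * of_real (k t)"
          by (simp add: algebra_simps flip: exp_add mult.assoc)
        finally show ?thesis by (simp add: sums_iff)
      qed
      moreover have "(\<integral>t. f n t \<partial>M) = (\<integral>t. c n t \<partial>M) * (s - s0) ^ n" for n
        by (simp add: f_def)
      ultimately show ?thesis by simp
    qed
    hence "?I holomorphic_on ball s0 d" by (rule power_series_holomorphic)
    thus ?thesis using d by (meson centre_in_ball holomorphic_on_imp_differentiable_at open_ball)
  qed
  thus ?thesis by (auto simp: holomorphic_on_def intro: field_differentiable_at_within)
qed

section \<open>The functional equation of the Riemann zeta function\<close>

text \<open>The Riemann zeta function for real \<open>x > 1\<close>. Values further left come only
  from the meromorphic function whose existence is assumed.\<close>

definition real_zeta :: "real \<Rightarrow> real" where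
  "real_zeta x = (\<Sum>n. real (Suc n) powr (-x))"

lemma sums_real_zeta: "x > 1 \<Longrightarrow> (\<lambda>n. real (Suc n) powr (-x)) sums real_zeta x"
  using summable_real_powr_iff[of "-x"] summable_Suc_iff[of "\<lambda>n. real n powr (-x)"]
  by (simp add: real_zeta_def summable_sums del: of_nat_Suc)

lemma real_zeta_ge_1:
  assumes "x > 1" shows "real_zeta x \<ge> 1"
  using sum_le_suminf[OF sums_summable[OF sums_real_zeta[OF assms]], of "{0}"]
  by (simp add: real_zeta_def)

lemma has_mellin_bose:
  assumes "x > 1"
  shows "has_mellin (\<lambda>t. 1 / (exp t - 1)) x (Gamma x * real_zeta x)"
proof (rule has_mellin_sums)
  fix n
  show "has_mellin (\<lambda>t. exp (- (real (Suc n) * t))) x (real (Suc n) powr (-x) * Gamma x)"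
    using has_mellin_scale[OF has_mellin_exp, of x "real (Suc n)"] assms by simp
next
  fix t :: real assume t: "t > 0"
  have "(\<lambda>n. exp (-t) ^ Suc n) sums (exp (-t) * (1 / (1 - exp (-t))))"
    using t sums_mult[OF geometric_sums[of "exp (-t)"], of "exp (-t)"] by simp
  also have "exp (-t) * (1 / (1 - exp (-t))) = 1 / (exp t - 1)"
    using t by (simp add: exp_minus divide_simps)
  also have "(\<lambda>n. exp (-t) ^ Suc n) = (\<lambda>n. exp (- (real (Suc n) * t)))"
    by (metis exp_of_nat_mult mult_minus_right)
  finally show "(\<lambda>n. exp (- (real (Suc n) * t))) sums (1 / (exp t - 1))" .
next
  show "(\<lambda>n. real (Suc n) powr (-x) * Gamma x) sums (Gamma x * real_zeta x)"
    using sums_mult[OF sums_real_zeta[OF assms], of "Gamma x"] by (simp add: mult_ac)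
qed auto

text \<open>Each partial fraction is \<open>2 * t / (1 + t\<^sup>2)\<close> rescaled by
  \<open>1 / (2 * pi * Suc n)\<close>. Scaling produces \<open>Suc n powr (x - 1)\<close>, summable
  because \<open>x < 0\<close>.\<close>

lemma has_mellin_bose_regularized:
  assumes "-1 < x" "x < 0"
  shows "has_mellin (\<lambda>t. 1 / (exp t - 1) - 1 / t + 1 / 2) x
           ((2 * pi) powr (x - 1) * pi / cos (pi * x / 2) * real_zeta (1 - x))"
proof (rule has_mellin_sums)
  fix n
  let ?a = "2 * pi * real (Suc n)"
  have a: "?a > 0" by simp
  have "has_mellin (\<lambda>t. 1 / ?a * (2 * (1 / ?a * t) / (1 + (1 / ?a * t)\<^sup>2))) x
          (1 / ?a * ((1 / ?a) powr (-x) * (pi / cos (pi * x / 2))))"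
    using assms a by (intro has_mellin_cmult has_mellin_scale[OF has_mellin_rational]) auto
  thus "has_mellin (\<lambda>t. 2 * t / (t\<^sup>2 + ?a\<^sup>2)) x
     ((2 * pi) powr (x - 1) * pi / cos (pi * x / 2) * real (Suc n) powr (- (1 - x)))"
  proof (rule has_mellin_cong)
    fix t :: real
    have "?a\<^sup>2 * (1 + (1 / ?a * t)\<^sup>2) = t\<^sup>2 + ?a\<^sup>2"
      using a by (simp add: power_mult_distrib power_divide distrib_left del: of_nat_Suc)
    moreover have "1 / ?a * (2 * (1 / ?a * t) / (1 + (1 / ?a * t)\<^sup>2)) = 2 * t / (?a\<^sup>2 * (1 + (1 / ?a * t)\<^sup>2))"
      by (simp add: power2_eq_square del: of_nat_Suc)
    ultimately show "1 / ?a * (2 * (1 / ?a * t) / (1 + (1 / ?a * t)\<^sup>2)) = 2 * t / (t\<^sup>2 + ?a\<^sup>2)" by simp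
  next
    have "1 / ?a * (1 / ?a) powr (-x) = ?a powr (x - 1)"
      using a by (simp add: powr_divide powr_minus powr_diff field_simps del: of_nat_Suc)
    also have "\<dots> = (2 * pi) powr (x - 1) * real (Suc n) powr (- (1 - x))"
      by (simp add: powr_mult del: of_nat_Suc)
    finally show "1 / ?a * ((1 / ?a) powr (-x) * (pi / cos (pi * x / 2))) =
        (2 * pi) powr (x - 1) * pi / cos (pi * x / 2) * real (Suc n) powr (- (1 - x))"
      by (simp add: mult_ac del: of_nat_Suc)
  qed
next
  show "(\<lambda>n. (2 * pi) powr (x - 1) * pi / cos (pi * x / 2) * real (Suc n) powr (- (1 - x))) sums
    ((2 * pi) powr (x - 1) * pi / cos (pi * x / 2) * real_zeta (1 - x))"
    using assms by (intro sums_mult sums_real_zeta) auto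
qed (use bose_partial_fractions in auto)

section \<open>Identity theorem along the real axis\<close>

lemma eventually_at_of_real:
  assumes "eventually P (at (of_real x :: complex))"
  shows "eventually (\<lambda>y. P (of_real y)) (at x)"
proof -
  have "filterlim complex_of_real (at (of_real x)) (at x)"
    by (auto simp: filterlim_at eventually_at_filter intro!: tendsto_intros)
  with assms show ?thesis by (simp add: filterlim_iff)
qed

text \<open>On a connected open set the difference is either zero or nonzero off a sparse set;
  agreement on a punctured real neighbourhood excludes the second case.\<close>

lemma meromorphic_eq_cosparse_of_real:
  assumes "f meromorphic_on A" "g meromorphic_on A" "open A" "connected A" "complex_of_real x \<in> A"
    and "eventually (\<lambda>y. f (of_real y) = g (of_real y)) (at x)"
  shows "eventually (\<lambda>z. f z = g z) (cosparse A)"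
proof -
  have "\<not> eventually (\<lambda>z. f z - g z \<noteq> 0) (cosparse A)"
  proof
    assume "eventually (\<lambda>z. f z - g z \<noteq> 0) (cosparse A)"
    hence "eventually (\<lambda>z. f z - g z \<noteq> 0) (at (of_real x))"
      using assms by (auto simp: eventually_cosparse_open_eq)
    from eventually_conj[OF eventually_at_of_real[OF this] assms(6)]
    have "eventually (\<lambda>_. False) (at x)" by (auto elim: eventually_mono)
    thus False by simp
  qed
  moreover have "(\<lambda>z. f z - g z) meromorphic_on A" using assms by (intro meromorphic_intros)
  ultimately have "eventually (\<lambda>z. f z - g z = 0) (cosparse A)"
    using meromorphic_imp_constant_or_avoid assms(3,4) by blast
  thus ?thesis by simp
qed

text \<open>In the combination \<open>f(t) - 3 f(2t) + 2 f(4t)\<close> the terms \<open>1 / t\<close> and \<open>1 / 2\<close> cancel, so both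
  expansions compute its Mellin transform, which converges on the whole half plane
  \<open>Re s > -1\<close>. The factor \<open>three_term\<close> is the effect of the combination on a Mellin transform.\<close>

definition three_term :: "real \<Rightarrow> real" where
  "three_term x = 1 - 3 * 2 powr (-x) + 2 * 4 powr (-x)"

lemma has_mellin_three_term:
  assumes "has_mellin f x v"
  shows "has_mellin (\<lambda>t. f t + (-3 * f (2 * t) + 2 * f (4 * t))) x (three_term x * v)"
  by (rule has_mellin_cong[OF has_mellin_add[OF assms has_mellin_add[OF
        has_mellin_cmult[where c = "-3", OF has_mellin_scale[OF assms, of 2]]
        has_mellin_cmult[where c = 2, OF has_mellin_scale[OF assms, of 4]]]]])
     (auto simp: three_term_def algebra_simps)

text \<open>In terms of \<open>q = 2 powr (-x)\<close> the factor is (1 - q)(1 - 2q), so its only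
  real zeros are 0 and 1.\<close>

lemma three_term_nonzero:
  assumes "x < 0" shows "three_term x \<noteq> 0"
proof -
  define q where "q = 2 powr (-x)"
  have "4 powr (-x) = q * q"
    by (simp add: q_def flip: powr_mult)
  hence "three_term x = (1 - q) * (1 - 2 * q)"
    by (simp add: three_term_def q_def algebra_simps)
  moreover have "q > 1" using assms by (simp add: q_def)
  ultimately show ?thesis by simp
qed

definition bose_three_term :: "real \<Rightarrow> real" where
  "bose_three_term t = 1 / (exp t - 1) + (-3 * (1 / (exp (2 * t) - 1)) + 2 * (1 / (exp (4 * t) - 1)))"

lemma has_mellin_bose_three_term_gt_1:
  "x > 1 \<Longrightarrow> has_mellin bose_three_term x (three_term x * (Gamma x * real_zeta x))"
  using has_mellin_three_term[OF has_mellin_bose] by (simp add: bose_three_term_def [abs_def])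

lemma has_mellin_bose_three_term_neg:
  assumes "-1 < x" "x < 0"
  shows "has_mellin bose_three_term x
    (three_term x * ((2 * pi) powr (x - 1) * pi / cos (pi * x / 2) * real_zeta (1 - x)))"
proof (rule has_mellin_cong[OF has_mellin_three_term[OF has_mellin_bose_regularized[OF assms]]])
  fix t :: real
  have "1 / (2 * t) = (1 / t) / 2" "1 / (4 * t) = (1 / t) / 4" by simp_all
  \<comment> \<open>Here \<open>u\<close> is \<open>1 / t\<close>. The weights 1, -3, 2 cancel it
    since 1 - 3/2 + 2/4 = 0, and cancel the constant since 1 - 3 + 2 = 0.\<close>
  moreover have "a - u + 1 / 2 + (-3 * (b - u / 2 + 1 / 2) + 2 * (c - u / 4 + 1 / 2)) = a + (-3 * b + 2 * c)"
    for a b c u :: real by (simp add: field_simps)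
  ultimately show "1 / (exp t - 1) - 1 / t + 1 / 2 +
         (-3 * (1 / (exp (2 * t) - 1) - 1 / (2 * t) + 1 / 2) +
          2 * (1 / (exp (4 * t) - 1) - 1 / (4 * t) + 1 / 2)) = bose_three_term t"
    by (simp only: bose_three_term_def)
qed simp

text \<open>The smaller exponent dominates for \<open>t \<le> 1\<close> and the larger one for
  \<open>t > 1\<close>, so convergence at two points gives convergence between them.\<close>

lemma integrable_mellin_between:
  assumes "has_mellin f x v" "has_mellin f y w" "x \<le> z" "z \<le> y" "f \<in> borel_measurable borel"
  shows "integrable lborel (\<lambda>t. indicat_real {0<..} t * (t powr (z - 1) * f t))"
proof (rule Bochner_Integration.integrable_bound)
  show "integrable lborel (\<lambda>t. norm (indicat_real {0<..} t * (t powr (x - 1) * f t)) +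
          norm (indicat_real {0<..} t * (t powr (y - 1) * f t)))"
    using assms by (auto simp: has_mellin_def has_bochner_integral_iff)
  have "t powr (z - 1) \<le> t powr (x - 1) + t powr (y - 1)" if "t > 0" for t :: real
  proof (cases "t \<le> 1")
    case True
    hence "t powr (z - 1) \<le> t powr (x - 1)" using that assms by (intro powr_mono') auto
    thus ?thesis by (simp add: add_increasing2)
  next
    case False
    hence "t powr (z - 1) \<le> t powr (y - 1)" using that assms by (intro powr_mono) auto
    thus ?thesis by (simp add: add_increasing)
  qed
  hence "norm (indicat_real {0<..} t * (t powr (z - 1) * f t)) \<le>
         norm (norm (indicat_real {0<..} t * (t powr (x - 1) * f t)) +
          norm (indicat_real {0<..} t * (t powr (y - 1) * f t)))" for t
    by (auto simp: indicator_def abs_mult mult_right_mono simp flip: distrib_right)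
  thus "AE t in lborel. norm (indicat_real {0<..} t * (t powr (z - 1) * f t)) \<le>
         norm (norm (indicat_real {0<..} t * (t powr (x - 1) * f t)) +
          norm (indicat_real {0<..} t * (t powr (y - 1) * f t)))" by simp
qed (use assms(5) in measurable)

text \<open>The three-term transform \<open>I\<close> is holomorphic on \<open>Re s > -1\<close>. It
  equals \<open>Gamma s * P s * F s\<close> there by continuation from the right, and it has the
  reflected form on (-1, 0); comparing the two on that interval gives the equation.\<close>

lemma zeta_functional_equation:
  fixes F :: "complex \<Rightarrow> complex"
  assumes mero: "F meromorphic_on UNIV"
    and F: "\<And>x. x > 1 \<Longrightarrow> F (of_real x) = of_real (real_zeta x)"
  shows "\<forall>\<^sub>\<approx>s\<in>UNIV. F s =
    2 * of_real (2 * pi) powr (s - 1) * sin (of_real pi * s / 2) * Gamma (1 - s) * F (1 - s)"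
proof -
  \<comment> \<open>Absorbing \<open>1 / t\<close> and the indicator into \<open>k\<close> turns the
    Mellin kernel into \<open>exp (s * ln t)\<close>, so \<open>holomorphic_laplace\<close> applies
    with \<open>u = ln\<close>.\<close>
  define k where "k = (\<lambda>t. indicat_real {0<..} t * bose_three_term t / t)"
  define I where "I = (\<lambda>s::complex. \<integral>t. exp (s * of_real (ln t)) * of_real (k t) \<partial>lborel)"
  define P where "P = (\<lambda>s::complex. 1 - 3 * 2 powr (-s) + 2 * 4 powr (-s))"
  define H where "H = {s. Re s > -1}"
  have H: "open H" "convex H" unfolding H_def by (simp_all add: open_halfspace_Re_gt convex_halfspace_Re_gt)
  have k_eq: "exp (x * ln t) * k t = indicat_real {0<..} t * (t powr (x - 1) * bose_three_term t)" for x t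
  proof (cases "t > 0")
    case True
    have "t powr (x - 1) = t powr x / t" using True by (simp add: powr_diff)
    also have "t powr x = exp (x * ln t)" using True by (simp add: powr_def)
    finally show ?thesis using True by (simp add: k_def)
  qed (simp add: k_def)
  have meas: "bose_three_term \<in> borel_measurable borel"
    unfolding bose_three_term_def by measurable
  have I_real: "I (of_real x) = of_real v" if "has_mellin bose_three_term x v" for x v
  proof -
    have "I (of_real x) = (\<integral>t. complex_of_real (exp (x * ln t) * k t) \<partial>lborel)"
      unfolding I_def by (simp flip: exp_of_real)
    also have "\<dots> = of_real (\<integral>t. exp (x * ln t) * k t \<partial>lborel)"
      by (rule integral_complex_of_real)
    finally show ?thesis
      using that by (simp add: k_eq has_mellin_def has_bochner_integral_iff)
  qed
  have P_real: "P (of_real x) = of_real (three_term x)" for x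
    by (simp add: P_def three_term_def flip: powr_of_real)
  have "I holomorphic_on H" unfolding I_def H_def
  proof (rule holomorphic_laplace)
    fix x :: real assume x: "-1 < x"
    \<comment> \<open>Two points enclosing \<open>x\<close>: one in (-1, 0), one above 1, where the
      transform is known to converge.\<close>
    have "-1 < min x (-1/2)" "min x (-1/2) < 0" "max x 2 > 1" using x by auto
    from integrable_mellin_between[OF has_mellin_bose_three_term_neg[OF this(1,2)]
          has_mellin_bose_three_term_gt_1[OF this(3)] _ _ meas, of x]
    show "integrable lborel (\<lambda>t. exp (x * ln t) * k t)" by (simp add: k_eq)
  qed (use meas in \<open>auto simp: k_def\<close>)
  hence I: "I meromorphic_on H"
    using H by (intro analytic_on_imp_meromorphic_on) (simp add: analytic_on_open)
  have Pan: "P meromorphic_on UNIV" unfolding P_def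
    by (intro analytic_on_imp_meromorphic_on analytic_intros) auto
  have Gmero: "Gamma meromorphic_on A" for A :: "complex set"
  proof -
    have "(\<lambda>z. inverse (rGamma z)) meromorphic_on A"
      by (intro meromorphic_intros analytic_on_imp_meromorphic_on analytic_intros)
    thus ?thesis by (simp add: rGamma_inverse_Gamma)
  qed
  \<comment> \<open>The identity holds for real arguments near 2 and spreads over the connected half
    plane, reaching the interval (-1, 0).\<close>
  have 1: "eventually (\<lambda>s. Gamma s * (P s * F s) = I s) (cosparse H)"
  proof (rule meromorphic_eq_cosparse_of_real)
    show "(\<lambda>s. Gamma s * (P s * F s)) meromorphic_on H"
      using mero Pan by (intro meromorphic_intros Gmero) (auto intro: meromorphic_on_subset)
    show "complex_of_real 2 \<in> H" by (simp add: H_def)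
    have "eventually (\<lambda>x. x > 1) (at (2::real))"
      using eventually_at_in_open'[of "{1<..}" "2::real"] by simp
    thus "eventually (\<lambda>x. Gamma (of_real x) * (P (of_real x) * F (of_real x)) = I (of_real x)) (at (2::real))"
    proof eventually_elim
      case (elim x)
      thus ?case
        using I_real[OF has_mellin_bose_three_term_gt_1[of x]]
        by (simp add: F P_real Gamma_complex_of_real)
    qed
  qed (use H I convex_connected in auto)
  \<comment> \<open>Reflection gives \<open>Gamma x * Gamma (1 - x) = pi / sin (pi * x)\<close>;
    doubling the angle in the sine isolates \<open>pi / cos (pi * x / 2)\<close> and lets
    \<open>Gamma x\<close> be factored out for later cancellation.\<close>
  have refl: "(2 * pi) powr (x - 1) * pi / cos (pi * x / 2) * real_zeta (1 - x) =
      Gamma x * (2 * (2 * pi) powr (x - 1) * sin (pi * x / 2) * Gamma (1 - x) * real_zeta (1 - x))"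
    if x: "-1 < x" "x < 0" for x :: real
  proof -
    have "pi * (-1) < pi * x" "pi * x < 0" using x by (simp_all only: mult_less_cancel_left_pos pi_gt_zero mult_pos_neg)
    hence b: "- pi < pi * x" "pi * x < 0" by simp_all
    hence "cos (pi * x / 2) > 0" using x by (intro cos_gt_zero_pi) auto
    moreover have "sin (pi * x / 2) < 0"
      using sin_gt_zero[of "- (pi * x / 2)"] b x by simp
    ultimately have nz: "sin (pi * x / 2) \<noteq> 0" "cos (pi * x / 2) \<noteq> 0" by auto
    have "complex_of_real (Gamma x * Gamma (1 - x)) = Gamma (of_real x) * Gamma (1 - of_real x)"
      using Gamma_complex_of_real[of x] Gamma_complex_of_real[of "1 - x"] by simp
    also have "\<dots> = of_real pi / sin (of_real pi * of_real x)"
      by (rule Gamma_reflection_complex)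
    also have "\<dots> = of_real (pi / sin (pi * x))"
      by (simp only: of_real_mult[symmetric] sin_of_real of_real_divide)
    finally have "Gamma x * Gamma (1 - x) = pi / sin (pi * x)"
      by (simp only: of_real_eq_iff)
    also have "sin (pi * x) = 2 * sin (pi * x / 2) * cos (pi * x / 2)"
      using sin_double[of "pi * x / 2"] by simp
    finally have eq: "pi / cos (pi * x / 2) = Gamma x * Gamma (1 - x) * (2 * sin (pi * x / 2))"
      using nz by (simp add: field_simps)
    have "(2 * pi) powr (x - 1) * pi / cos (pi * x / 2) * real_zeta (1 - x) =
        (2 * pi) powr (x - 1) * (pi / cos (pi * x / 2)) * real_zeta (1 - x)" by simp
    thus ?thesis unfolding eq by (simp add: mult_ac)
  qed
  show ?thesis
  proof (rule meromorphic_eq_cosparse_of_real)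
    have M1: "(\<lambda>s. Gamma (1 - s)) meromorphic_on (UNIV :: complex set)"
      by (rule meromorphic_on_compose[OF Gmero]) (auto intro: analytic_intros)
    have M2: "(\<lambda>s. F (1 - s)) meromorphic_on (UNIV :: complex set)"
      by (rule meromorphic_on_compose[OF mero]) (auto intro: analytic_intros)
    have M3: "(\<lambda>s. 2 * of_real (2 * pi) powr (s - 1) * sin (of_real pi * s / 2)) meromorphic_on (UNIV :: complex set)"
      by (intro analytic_on_imp_meromorphic_on analytic_intros) (auto simp: complex_nonpos_Reals_iff not_le)
    show "(\<lambda>s. 2 * of_real (2 * pi) powr (s - 1) * sin (of_real pi * s / 2) * Gamma (1 - s) * F (1 - s)) meromorphic_on UNIV"
      by (rule meromorphic_on_mult[OF meromorphic_on_mult[OF M3 M1] M2])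
    have "eventually (\<lambda>s. Gamma s * (P s * F s) = I s) (at (of_real (-1/2)))"
      using 1 H by (auto simp: eventually_cosparse_open_eq H_def)
    hence "eventually (\<lambda>x. Gamma (of_real x) * (P (of_real x) * F (of_real x)) = I (of_real x)) (at (-1/2::real))"
      by (rule eventually_at_of_real)
    moreover have "eventually (\<lambda>x. x \<in> {-1<..<0}) (at (-1/2::real))"
      by (rule eventually_at_in_open') auto
    ultimately show "\<forall>\<^sub>F x in at (-1/2). F (of_real x) =
       2 * of_real (2 * pi) powr (of_real x - 1) * sin (of_real pi * of_real x / 2) * Gamma (1 - of_real x) * F (1 - of_real x)"
    proof eventually_elim
      case (elim x)
      hence x: "-1 < x" "x < 0" by auto
      \<comment> \<open>\<open>Gamma\<close> takes the value 0 only by convention at its poles, so a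
        non-integral \<open>x\<close> allows division by \<open>Gamma x\<close>.\<close>
      have "x \<notin> \<int>"
      proof
        assume "x \<in> \<int>" then obtain n where "x = of_int n" by (auto elim: Ints_cases)
        with x have "-1 < n" "n < 0" by linarith+
        thus False by simp
      qed
      hence G: "Gamma x \<noteq> 0" using nonpos_Ints_Int by (auto simp: Gamma_eq_zero_iff)
      have "Gamma (of_real x) * (P (of_real x) * F (of_real x)) =
         of_real (three_term x * (Gamma x * (2 * (2 * pi) powr (x - 1) * sin (pi * x / 2) * Gamma (1 - x) * real_zeta (1 - x))))"
        using elim I_real[OF has_mellin_bose_three_term_neg[OF x]] by (simp only: refl[OF x])
      hence "of_real (Gamma x * three_term x) * F (of_real x) = of_real (Gamma x * three_term x) *
         of_real (2 * (2 * pi) powr (x - 1) * sin (pi * x / 2) * Gamma (1 - x) * real_zeta (1 - x))"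
        by (simp add: P_real Gamma_complex_of_real mult_ac)
      hence "F (of_real x) = of_real (2 * (2 * pi) powr (x - 1) * sin (pi * x / 2) * Gamma (1 - x) * real_zeta (1 - x))"
        using G three_term_nonzero[OF x(2)] by (subst (asm) mult_cancel_left) auto
      moreover have "complex_of_real ((2 * pi) powr (x - 1)) = of_real (2 * pi) powr (of_real x - 1)"
        by (subst powr_of_real[symmetric]) auto
      moreover have "complex_of_real (sin (pi * x / 2)) = sin (of_real pi * of_real x / 2)"
        by (simp flip: sin_of_real)
      moreover have "complex_of_real (Gamma (1 - x)) = Gamma (1 - of_real x)"
        using Gamma_complex_of_real[of "1 - x"] by simp
      moreover have "F (1 - of_real x) = of_real (real_zeta (1 - x))"
        using F[of "1 - x"] x by simp
      ultimately show ?case by simp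
    qed
  qed (use mero in auto)
qed

section \<open>Lattice sums\<close>

abbreviation nz_lattice :: "(int \<times> int) set" where
  "nz_lattice \<equiv> UNIV - {(0, 0)}"

text \<open>The norm whose unit ball is the square.\<close>

definition sup_norm :: "int \<times> int \<Rightarrow> real" where
  "sup_norm p = real_of_int (max \<bar>fst p\<bar> \<bar>snd p\<bar>)"

lemma sup_norm_ge_1: "p \<in> nz_lattice \<Longrightarrow> sup_norm p \<ge> 1"
  by (cases p) (auto simp: sup_norm_def)

text \<open>A shell is the difference of two consecutive boxes, and (2k + 3)^2 - (2k + 1)^2 = 8(k +
  1).\<close>

lemma card_sup_norm_shell:
  defines "shell \<equiv> \<lambda>k. {p. sup_norm p = real (Suc k)}"
  shows "finite (shell k)" "card (shell k) = 8 * Suc k"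
proof -
  define box where "box = (\<lambda>k::nat. {- int k..int k} \<times> {- int k..int k})"
  have sub: "box k \<subseteq> box (Suc k)" by (auto simp: box_def)
  have "shell k = box (Suc k) - box k"
    by (auto simp: shell_def box_def sup_norm_def)
  moreover have "finite (box k)" "card (box k) = (2 * k + 1) * (2 * k + 1)" for k
    by (simp_all add: box_def card_cartesian_product nat_add_distrib nat_mult_distrib)
  ultimately show "finite (shell k)" "card (shell k) = 8 * Suc k"
    using card_Diff_subset[OF _ sub] by (simp_all add: algebra_simps)
qed

text \<open>Grouping by shells, the \<open>8 * n\<close> points of norm \<open>n\<close> contribute
  \<open>8 * n powr (1 - 2 * x)\<close>.\<close>

lemma has_sum_sup_norm:
  assumes "x > 1"
  shows "((\<lambda>p. sup_norm p powr (-2 * x)) has_sum (8 * real_zeta (2 * x - 1))) nz_lattice"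
proof -
  define shell where "shell = (\<lambda>k. {p. sup_norm p = real (Suc k)})"
  define g where "g = (\<lambda>k. 8 * real (Suc k) powr (- (2 * x - 1)))"
  have inner: "((\<lambda>p. sup_norm p powr (-2 * x)) has_sum g k) (shell k)" for k
  proof (rule has_sum_finiteI)
    have "(\<Sum>p\<in>shell k. sup_norm p powr (-2 * x)) = (\<Sum>p\<in>shell k. real (Suc k) powr (-2 * x))"
      by (rule sum.cong) (auto simp: shell_def)
    also have "\<dots> = 8 * (real (Suc k) * real (Suc k) powr (-2 * x))"
      using card_sup_norm_shell(2)[of k] by (simp add: shell_def)
    also have "real (Suc k) * real (Suc k) powr (-2 * x) = real (Suc k) powr (1 + -2 * x)"
      by (subst powr_add) simp
    finally show "g k = (\<Sum>p\<in>shell k. sup_norm p powr (-2 * x))"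
      by (simp add: g_def)
  qed (use card_sup_norm_shell in \<open>simp add: shell_def\<close>)
  have "g sums (8 * real_zeta (2 * x - 1))"
    unfolding g_def using assms by (intro sums_mult sums_real_zeta) auto
  hence outer: "(g has_sum (8 * real_zeta (2 * x - 1))) UNIV"
    by (subst sums_nonneg_imp_has_sum_strong) (auto simp: g_def)
  have "((\<lambda>(k, p). sup_norm p powr (-2 * x)) has_sum (8 * real_zeta (2 * x - 1))) (SIGMA k:UNIV. shell k)"
  proof (rule has_sum_SigmaI)
    show "(\<lambda>(k, p). sup_norm p powr (-2 * x)) summable_on (SIGMA k:UNIV. shell k)"
      by (rule summable_on_SigmaI[where g = g]) (use inner outer in \<open>auto simp: summable_on_def\<close>)
  qed (use inner outer in auto)
  \<comment> \<open>A point determines its shell, so forgetting the shell index is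
    injective.\<close>
  also have "?this \<longleftrightarrow> ((\<lambda>p. sup_norm p powr (-2 * x)) has_sum (8 * real_zeta (2 * x - 1))) (snd ` (SIGMA k:UNIV. shell k))"
    by (subst has_sum_reindex) (auto simp: inj_on_def shell_def o_def case_prod_unfold)
  also have "snd ` (SIGMA k:UNIV. shell k) = nz_lattice"
  proof (intro equalityI subsetI)
    fix p assume "p \<in> nz_lattice"
    then obtain m n where p: "p = (m, n)" "(m, n) \<noteq> (0, 0)" by (cases p) auto
    \<comment> \<open>Shell 0 has norm 1, hence the predecessor of the maximum.\<close>
    hence "sup_norm (m, n) = real (Suc (nat (max \<bar>m\<bar> \<bar>n\<bar>) - 1))" by (auto simp: sup_norm_def)
    hence "(nat (max \<bar>m\<bar> \<bar>n\<bar>) - 1, (m, n)) \<in> (SIGMA k:UNIV. shell k)" by (simp add: shell_def)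
    thus "p \<in> snd ` (SIGMA k:UNIV. shell k)" unfolding p(1) by (metis image_eqI snd_conv)
  qed (auto simp: shell_def sup_norm_def)
  finally show ?thesis .
qed

section \<open>Comparison of Hlawka series with the sup-norm series\<close>

definition norm_sq :: "int \<times> int \<Rightarrow> real" where
  "norm_sq p = real_of_int ((fst p)\<^sup>2 + (snd p)\<^sup>2)"

definition hlawka_term :: "(real \<Rightarrow> real) \<Rightarrow> real \<Rightarrow> int \<times> int \<Rightarrow> real" where
  "hlawka_term \<rho> x p = \<rho> (Arg (Complex (of_int (fst p)) (of_int (snd p)))) powr (2 * x) * norm_sq p powr (-x)"

lemma norm_sq_bounds:
  "sup_norm p powr 2 \<le> norm_sq p" "norm_sq p \<le> 2 * sup_norm p powr 2"
proof -
  obtain m n where p: "p = (m, n)" by (cases p)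
  have "sup_norm p powr 2 = real_of_int ((max \<bar>m\<bar> \<bar>n\<bar>)\<^sup>2)"
    by (simp add: p sup_norm_def powr_numeral)
  moreover have "(max \<bar>m\<bar> \<bar>n\<bar>)\<^sup>2 \<le> m\<^sup>2 + n\<^sup>2" by (simp add: max_def)
  moreover have "m\<^sup>2 \<le> (max \<bar>m\<bar> \<bar>n\<bar>)\<^sup>2" "n\<^sup>2 \<le> (max \<bar>m\<bar> \<bar>n\<bar>)\<^sup>2"
    by (simp_all add: abs_le_square_iff[symmetric])
  ultimately show "sup_norm p powr 2 \<le> norm_sq p" "norm_sq p \<le> 2 * sup_norm p powr 2"
    unfolding p norm_sq_def fst_conv snd_conv by linarith+
qed

text \<open>\<open>Arg\<close> takes values in a compact interval, on which the continuous positive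
  function attains its bounds. Taking \<open>C \<ge> 1\<close> makes \<open>C powr (2 * x)\<close>
  nondecreasing in \<open>x\<close>.\<close>

lemma polar_function_bounds:
  assumes "polar_function \<rho>"
  obtains c C where "0 < c" "c \<le> 1" "1 \<le> C" "\<And>z. c \<le> \<rho> (Arg z)" "\<And>z. \<rho> (Arg z) \<le> C"
proof -
  have cont: "continuous_on {-pi..pi} \<rho>" and pos: "\<rho> x > 0" for x
    using assms by (auto simp: polar_function_def intro: continuous_on_subset)
  obtain a where a: "\<And>x. x \<in> {-pi..pi} \<Longrightarrow> \<rho> a \<le> \<rho> x"
    using continuous_attains_inf[OF _ _ cont] by force
  obtain b where b: "\<And>x. x \<in> {-pi..pi} \<Longrightarrow> \<rho> x \<le> \<rho> b"
    using continuous_attains_sup[OF _ _ cont] by force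
  have Arg: "Arg z \<in> {-pi..pi}" for z using Arg_bounded[of z] by auto
  show ?thesis
    by (rule that[of "min 1 (\<rho> a)" "max 1 (\<rho> b)"])
       (use a[OF Arg] b[OF Arg] pos in \<open>auto simp: min_le_iff_disj le_max_iff_disj\<close>)
qed

lemma hlawka_term_nonneg: "hlawka_term \<rho> x p \<ge> 0"
  by (simp add: hlawka_term_def)

lemma hlawka_term_upper:
  assumes "\<And>z. 0 < \<rho> (Arg z)" "\<And>z. \<rho> (Arg z) \<le> C" "x > 0" "p \<in> nz_lattice"
  shows "hlawka_term \<rho> x p \<le> C powr (2 * x) * sup_norm p powr (-2 * x)"
  unfolding hlawka_term_def
proof (rule mult_mono)
  have "sup_norm p powr 2 > 0" using sup_norm_ge_1[OF assms(4)] by simp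
  hence "norm_sq p powr (-x) \<le> (sup_norm p powr 2) powr (-x)"
    using norm_sq_bounds(1)[of p] assms(3) by (intro powr_mono2') auto
  thus "norm_sq p powr (-x) \<le> sup_norm p powr (-2 * x)" by (simp add: powr_powr)
qed (use assms less_imp_le[OF assms(1)] in \<open>auto intro!: powr_mono2\<close>)

lemma hlawka_term_lower:
  assumes "0 < c" "\<And>z. c \<le> \<rho> (Arg z)" "x > 0" "p \<in> nz_lattice"
  shows "hlawka_term \<rho> x p \<ge> c powr (2 * x) * 2 powr (-x) * sup_norm p powr (-2 * x)"
proof -
  have "sup_norm p powr 2 > 0" using sup_norm_ge_1[OF assms(4)] by simp
  hence "norm_sq p > 0" using norm_sq_bounds(1)[of p] by linarith
  hence "(2 * sup_norm p powr 2) powr (-x) \<le> norm_sq p powr (-x)"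
    using norm_sq_bounds[of p] assms(3) by (intro powr_mono2') auto
  hence "2 powr (-x) * sup_norm p powr (-2 * x) \<le> norm_sq p powr (-x)"
    by (simp add: powr_mult powr_powr)
  thus ?thesis unfolding hlawka_term_def mult.assoc
    using assms by (intro mult_mono powr_mono2) auto
qed

lemma summable_hlawka_term:
  assumes "polar_function \<rho>" "x > 1"
  shows "hlawka_term \<rho> x summable_on nz_lattice"
proof -
  obtain c C where *: "0 < c" "c \<le> 1" "1 \<le> C" "\<And>z. c \<le> \<rho> (Arg z)" "\<And>z. \<rho> (Arg z) \<le> C"
    using polar_function_bounds[OF assms(1)] by metis
  show ?thesis
  proof (rule summable_on_comparison_test)
    show "(\<lambda>p. C powr (2 * x) * sup_norm p powr (-2 * x)) summable_on nz_lattice"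
      using has_sum_sup_norm[OF assms(2)] by (intro summable_on_cmult_right) (auto simp: summable_on_def)
  qed (use hlawka_term_nonneg hlawka_term_upper[of \<rho>, OF less_le_trans[OF *(1,4)] *(5)] assms(2) in auto)
qed

lemma hlawka_zeta_of_real:
  assumes "polar_function \<rho>" "x > 1"
  shows "hlawka_zeta \<rho> (of_real x) = of_real (\<Sum>\<^sub>\<infinity>p\<in>nz_lattice. hlawka_term \<rho> x p)"
proof -
  have "of_real (\<rho> (Arg (Complex (of_int m) (of_int n)))) powr (2 * of_real x)
        * of_int (m\<^sup>2 + n\<^sup>2) powr (- of_real x) = complex_of_real (hlawka_term \<rho> x (m, n))" for m n
  proof -
    let ?r = "\<rho> (Arg (Complex (of_int m) (of_int n)))"
    have "complex_of_real ?r powr (of_real (2 * x)) = of_real (?r powr (2 * x))"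
      using assms by (intro powr_of_real) (auto simp: polar_function_def less_imp_le)
    moreover have "complex_of_real (norm_sq (m, n)) powr (of_real (- x)) = of_real (norm_sq (m, n) powr (- x))"
      by (intro powr_of_real) (simp add: norm_sq_def)
    ultimately show ?thesis by (simp add: hlawka_term_def norm_sq_def)
  qed
  hence "hlawka_zeta \<rho> (of_real x) = (\<Sum>\<^sub>\<infinity>p\<in>nz_lattice. of_real (hlawka_term \<rho> x p))"
    unfolding hlawka_zeta_def by (simp add: case_prod_unfold)
  also have "\<dots> = of_real (\<Sum>\<^sub>\<infinity>p\<in>nz_lattice. hlawka_term \<rho> x p)"
    by (intro infsumI has_sum_of_real has_sum_infsum summable_hlawka_term assms)
  finally show ?thesis .
qed

text \<open>The constant is fixed before \<open>x\<close>, so the bound can be used uniformly along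
  a limit.\<close>

lemma hlawka_upper:
  assumes "polar_function \<rho>"
  obtains C where "C \<ge> 1"
    "\<And>x. x > 1 \<Longrightarrow> (\<Sum>\<^sub>\<infinity>p\<in>nz_lattice. hlawka_term \<rho> x p) \<le> C powr (2 * x) * (8 * real_zeta (2 * x - 1))"
proof -
  obtain c C where *: "0 < c" "c \<le> 1" "1 \<le> C" "\<And>z. c \<le> \<rho> (Arg z)" "\<And>z. \<rho> (Arg z) \<le> C"
    using polar_function_bounds[OF assms(1)] by metis
  show ?thesis
  proof (rule that[OF *(3)])
    fix x :: real assume x: "x > 1"
    show "(\<Sum>\<^sub>\<infinity>p\<in>nz_lattice. hlawka_term \<rho> x p) \<le> C powr (2 * x) * (8 * real_zeta (2 * x - 1))"
      by (rule has_sum_mono[OF has_sum_infsum[OF summable_hlawka_term[OF assms x]]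
            has_sum_cmult_right[OF has_sum_sup_norm[OF x]]])
         (use hlawka_term_upper[of \<rho>, OF less_le_trans[OF *(1,4)] *(5)] x in auto)
  qed
qed

lemma hlawka_lower:
  assumes "polar_function \<rho>"
  obtains c where "0 < c" "c \<le> 1"
    "\<And>x. x > 1 \<Longrightarrow> (\<Sum>\<^sub>\<infinity>p\<in>nz_lattice. hlawka_term \<rho> x p) \<ge> c powr (2 * x) * 2 powr (-x) * (8 * real_zeta (2 * x - 1))"
proof -
  obtain c C where *: "0 < c" "c \<le> 1" "1 \<le> C" "\<And>z. c \<le> \<rho> (Arg z)" "\<And>z. \<rho> (Arg z) \<le> C"
    using polar_function_bounds[OF assms(1)] by metis
  show ?thesis
  proof (rule that[OF *(1,2)])
    fix x :: real assume x: "x > 1"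
    show "(\<Sum>\<^sub>\<infinity>p\<in>nz_lattice. hlawka_term \<rho> x p) \<ge> c powr (2 * x) * 2 powr (-x) * (8 * real_zeta (2 * x - 1))"
      by (rule has_sum_mono[OF has_sum_cmult_right[OF has_sum_sup_norm[OF x]]
             has_sum_infsum[OF summable_hlawka_term[OF assms x]]])
         (use hlawka_term_lower[of c \<rho>, OF *(1,4)] x in auto)
  qed
qed

text \<open>A lattice point at angle \<open>t\<close> has sup-norm equal to its Euclidean norm
  divided by \<open>r t\<close>, because the boundary point at that angle has sup-norm 1. The Hlawka
  series is thus the sup-norm series.\<close>

lemma hlawka_zeta_square:
  assumes "polar_function r"
    and "range (\<lambda>\<theta>. (r \<theta> * cos \<theta>, r \<theta> * sin \<theta>)) = frontier ({-1..1} \<times> {-1..1})"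
    and "x > 1"
  shows "hlawka_zeta r (of_real x) = of_real (8 * real_zeta (2 * x - 1))"
proof -
  have max1: "max \<bar>r t * cos t\<bar> \<bar>r t * sin t\<bar> = 1" for t
  proof -
    have "(r t * cos t, r t * sin t) \<in> frontier ({-1..1} \<times> {-1..1})" using assms(2) by blast
    also have "frontier ({-1..1::real} \<times> {-1..1::real}) = {-1..1} \<times> {-1..1} - {-1<..<1} \<times> {-1<..<1}"
      by (simp add: frontier_def closure_Times interior_Times)
    finally show ?thesis by (auto simp: max_def abs_if split: if_splits)
  qed
  have "hlawka_term r x p = sup_norm p powr (-2 * x)" if "p \<in> nz_lattice" for p
  proof -
    obtain m n where p: "p = (m, n)" by (cases p)
    define z where "z = Complex (of_int m) (of_int n)"
    define t where "t = Arg z"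
    have r: "r t > 0" using assms(1) by (simp add: polar_function_def)
    have z: "z = rcis (cmod z) t" by (simp add: t_def rcis_cmod_Arg)
    have m: "real_of_int m = cmod z * cos t" and n: "real_of_int n = cmod z * sin t"
      using arg_cong[OF z, of Re] arg_cong[OF z, of Im] by (simp_all add: z_def)
    have "sup_norm p = max \<bar>real_of_int m\<bar> \<bar>real_of_int n\<bar>" by (simp add: sup_norm_def p of_int_max)
    also have "\<dots> = cmod z / r t * max \<bar>r t * cos t\<bar> \<bar>r t * sin t\<bar>"
      unfolding m n using r by (subst max_mult_distrib_left) (auto simp: abs_mult)
    finally have sup: "sup_norm p = cmod z / r t" by (simp only: max1 mult_1_right)
    have "norm_sq p = (cmod z)\<^sup>2" by (simp add: norm_sq_def p z_def cmod_power2)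
    moreover have "cmod z > 0" using that by (auto simp: p z_def complex_eq_iff)
    ultimately have euc: "norm_sq p = cmod z powr 2" by (simp add: powr_numeral)
    have "hlawka_term r x p = r t powr (2 * x) * cmod z powr (-2 * x)"
      unfolding hlawka_term_def euc powr_powr by (simp add: p t_def z_def)
    also have "\<dots> = sup_norm p powr (-2 * x)"
      unfolding sup using r by (simp add: powr_divide powr_minus field_simps)
    finally show ?thesis .
  qed
  hence "(\<Sum>\<^sub>\<infinity>p\<in>nz_lattice. hlawka_term r x p) = (\<Sum>\<^sub>\<infinity>p\<in>nz_lattice. sup_norm p powr (-2 * x))"
    by (rule infsum_cong)
  also have "\<dots> = 8 * real_zeta (2 * x - 1)"
    using has_sum_sup_norm[OF assms(3)] by (rule infsumI)
  finally show ?thesis by (simp add: hlawka_zeta_of_real[OF assms(1,3)])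
qed

section \<open>Zeta on the real half line beyond 1\<close>

lemma real_zeta_antimono:
  assumes "1 < x" "x \<le> y"
  shows "real_zeta y \<le> real_zeta x"
  by (rule sums_le[OF _ sums_real_zeta sums_real_zeta]) (use assms in \<open>auto intro!: powr_mono\<close>)

text \<open>A partial sum of the series is continuous at 1, where it is a harmonic number and can be
  made arbitrarily large.\<close>

lemma real_zeta_at_1: "filterlim real_zeta at_top (at_right 1)"
  unfolding filterlim_at_top
proof
  fix M :: real
  have "eventually (\<lambda>n. harm n > M) sequentially"
    using harm_at_top by (auto simp: filterlim_at_top_dense)
  then obtain N where N: "harm N > M" by (auto simp: eventually_sequentially)
  let ?f = "\<lambda>x. \<Sum>n<N. real (Suc n) powr (-x)"
  have "harm N = ?f 1"
    unfolding harm_def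
    by (rule sum.reindex_bij_witness[of _ Suc "\<lambda>n. n - 1"]) (auto simp: powr_minus_divide divide_inverse)
  moreover have "(?f \<longlongrightarrow> ?f 1) (at_right 1)"
    by (intro tendsto_intros) auto
  ultimately have "eventually (\<lambda>x. ?f x > M) (at_right 1)"
    using N order_tendstoD(1) by metis
  moreover have "eventually (\<lambda>x::real. x > 1) (at_right 1)" by (rule eventually_at_right_less)
  ultimately show "eventually (\<lambda>x. real_zeta x \<ge> M) (at_right 1)"
  proof eventually_elim
    case (elim x)
    have "?f x \<le> real_zeta x" unfolding real_zeta_def
      using sums_real_zeta[OF elim(2)] by (intro sum_le_suminf) (auto simp: sums_iff)
    with elim show ?case by simp
  qed
qed

section \<open>Gamma factors and the contradiction\<close>

lemma real_zeta_pos: "x > 1 \<Longrightarrow> real_zeta x > 0"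
  using real_zeta_ge_1[of x] by simp

text \<open>The factor in the functional equation, zeta(y) = \<open>zeta_factor y\<close> * zeta(1 -
  y), on the real line.\<close>

definition zeta_factor :: "real \<Rightarrow> real" where
  "zeta_factor y = 2 * (2 * pi) powr (y - 1) * sin (pi * y / 2) * Gamma (1 - y)"

lemma isCont_zeta_factor:
  assumes "y < 1" shows "isCont zeta_factor y"
proof -
  have "1 - y \<notin> \<int>\<^sub>\<le>\<^sub>0" using assms by (auto elim!: nonpos_Ints_cases)
  thus ?thesis unfolding zeta_factor_def
    by (intro continuous_intros) auto
qed

text \<open>Inverting the relation between \<open>Z\<close> and zeta,
  \<open>F w = Z ((w + 1) / 2) / 8\<close> continues zeta, so its functional equation applies at
  \<open>w = 2 * t - 1\<close>. The bound \<open>t0 < 1 / 2\<close> makes \<open>w\<close> negative,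
  so that \<open>1 - w\<close> lies in the range of the series.\<close>

lemma hlawka_square_left:
  assumes "polar_function r"
    and "range (\<lambda>\<theta>. (r \<theta> * cos \<theta>, r \<theta> * sin \<theta>)) = frontier ({-1..1} \<times> {-1..1})"
    and "hlawka_continuation r Z" "t0 < 1 / 2"
  shows "eventually (\<lambda>t. Z (of_real t) = of_real (8 * (zeta_factor (2 * t - 1) * real_zeta (2 - 2 * t)))) (at t0)"
proof -
  have Z: "Z meromorphic_on UNIV" "\<And>s. Re s > 1 \<Longrightarrow> Z s = hlawka_zeta r s"
    using assms(3) by (auto simp: hlawka_continuation_def)
  define F where "F = (\<lambda>w. Z ((w + 1) / 2) / 8)"
  have "F meromorphic_on UNIV"
    unfolding F_def
    by (intro meromorphic_intros meromorphic_on_compose[OF Z(1)] analytic_intros) auto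
  moreover have F: "F (of_real x) = of_real (real_zeta x)" if "x > 1" for x
  proof -
    have "(complex_of_real x + 1) / 2 = of_real ((x + 1) / 2)" by simp
    hence "F (of_real x) = hlawka_zeta r (of_real ((x + 1) / 2)) / 8"
      unfolding F_def using that by (simp add: Z(2) del: of_real_add of_real_divide)
    also have "hlawka_zeta r (of_real ((x + 1) / 2)) = of_real (8 * real_zeta (2 * ((x + 1) / 2) - 1))"
      using that by (intro hlawka_zeta_square[OF assms(1,2)]) simp
    also have "2 * ((x + 1) / 2) - 1 = x" by (simp add: field_simps)
    also have "complex_of_real (8 * real_zeta x) / 8 = of_real (real_zeta x)" by simp
    finally show ?thesis .
  qed
  ultimately have "\<forall>\<^sub>\<approx>s\<in>UNIV. F s =
    2 * of_real (2 * pi) powr (s - 1) * sin (of_real pi * s / 2) * Gamma (1 - s) * F (1 - s)"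
    by (rule zeta_functional_equation)
  hence "eventually (\<lambda>s. F s =
    2 * of_real (2 * pi) powr (s - 1) * sin (of_real pi * s / 2) * Gamma (1 - s) * F (1 - s)) (at (of_real (2 * t0 - 1)))"
    by (simp add: eventually_cosparse_open_eq)
  hence "eventually (\<lambda>y. F (of_real y) =
    2 * of_real (2 * pi) powr (of_real y - 1) * sin (of_real pi * of_real y / 2) * Gamma (1 - of_real y) * F (1 - of_real y)) (at (2 * t0 - 1))"
    by (rule eventually_at_of_real)
  moreover have "eventually (\<lambda>y. y < 0) (at (2 * t0 - 1))"
    using eventually_at_in_open'[of "{..<0}" "2 * t0 - 1"] assms(4) by simp
  ultimately have "eventually (\<lambda>y. F (of_real y) = of_real (zeta_factor y * real_zeta (1 - y))) (at (2 * t0 - 1))"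
  proof eventually_elim
    case (elim y)
    have "complex_of_real ((2 * pi) powr (y - 1)) = of_real (2 * pi) powr (of_real y - 1)"
      by (subst powr_of_real[symmetric]) auto
    moreover have "complex_of_real (sin (pi * y / 2)) = sin (of_real pi * of_real y / 2)"
      by (simp flip: sin_of_real)
    moreover have "complex_of_real (Gamma (1 - y)) = Gamma (1 - of_real y)"
      using Gamma_complex_of_real[of "1 - y"] by simp
    moreover have "F (1 - of_real y) = of_real (real_zeta (1 - y))"
      using F[of "1 - y"] elim by simp
    ultimately show ?case using elim(1) by (simp add: zeta_factor_def)
  qed
  moreover have "filterlim (\<lambda>t. 2 * t - 1) (at (2 * t0 - 1)) (at t0)"
    by (auto simp: filterlim_at eventually_at_filter intro!: tendsto_intros)
  ultimately have "eventually (\<lambda>t. F (of_real (2 * t - 1)) = of_real (zeta_factor (2 * t - 1) * real_zeta (1 - (2 * t - 1)))) (at t0)"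
    by (rule eventually_compose_filterlim)
  thus ?thesis
    by eventually_elim (simp add: F_def field_simps)
qed

section \<open>Zeros of gamma factors\<close>

lemma nonpos_Ints_not_Re_pos: "Re z > 0 \<Longrightarrow> z \<notin> \<int>\<^sub>\<le>\<^sub>0"
  by (auto elim!: nonpos_Ints_cases)

lemma isCont_powr_const:
  assumes "(c :: complex) \<noteq> 0" "isCont f z" shows "isCont (\<lambda>z. c powr f z) z"
  using assms by (auto simp: powr_def intro!: continuous_intros)

text \<open>Without poles in the denominator at 0, the reciprocal of the factor has a finite limit
  there, so the factor cannot tend to 0.\<close>

lemma gamma_factor_no_pole_imp_no_zero:
  assumes "\<And>j. j \<in> {1..K} \<Longrightarrow> \<omega> j \<notin> \<int>\<^sub>\<le>\<^sub>0"
    and "((\<lambda>t. gamma_factor A B k \<alpha> \<mu> K \<beta> \<omega> (of_real t)) \<longlongrightarrow> 0) (at_left 0)"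
    and "eventually (\<lambda>t. gamma_factor A B k \<alpha> \<mu> K \<beta> \<omega> (of_real t) \<noteq> 0) (at_left 0)"
  shows False
proof -
  let ?G = "gamma_factor A B k \<alpha> \<mu> K \<beta> \<omega>"
  \<comment> \<open>The reciprocal, written with the entire function \<open>rGamma\<close> so that
    poles in the numerator of the factor do no harm.\<close>
  define Q where "Q = (\<lambda>s. A powr (s - 1) * (\<Prod>i=1..k. rGamma (of_real (\<alpha> i) * (1 - s) + \<mu> i)) *
      (B powr s * (\<Prod>j=1..K. Gamma (of_real (\<beta> j) * s + \<omega> j))))"
  obtain t where "?G (of_real t) \<noteq> 0"
    using eventually_happens[OF assms(3)] by auto
  \<comment> \<open>A power of base 0 is 0, so a nonzero value excludes zero bases.\<close>
  hence AB: "A \<noteq> 0" "B \<noteq> 0" by (auto simp: gamma_factor_def)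
  have "isCont Q 0" unfolding Q_def
    using AB assms(1) by (intro continuous_intros isCont_powr_const) auto
  moreover have "filterlim complex_of_real (nhds 0) (at_left 0)"
    using tendsto_of_real[OF tendsto_ident_at, of "0::real" "{..<0}"] by simp
  ultimately have "((\<lambda>t. Q (of_real t)) \<longlongrightarrow> Q 0) (at_left 0)"
    by (rule isCont_tendsto_compose)
  from tendsto_mult[OF assms(2) this]
  have "((\<lambda>t. ?G (of_real t) * Q (of_real t)) \<longlongrightarrow> 0) (at_left 0)" by simp
  moreover have "eventually (\<lambda>t. ?G (of_real t) * Q (of_real t) = 1) (at_left 0)"
    using assms(3)
  proof eventually_elim
    case (elim t)
    have A: "A powr (1 - of_real t) * A powr (of_real t - 1) = 1"
      using AB by (simp flip: powr_add)
    \<comment> \<open>A nonzero factor excludes the conventional value 0 of \<open>Gamma\<close> at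
      its poles, so every product \<open>Gamma * rGamma\<close> is 1.\<close>
    have P: "(\<Prod>i=1..k. Gamma (of_real (\<alpha> i) * (1 - of_real t) + \<mu> i)) *
        (\<Prod>i=1..k. rGamma (of_real (\<alpha> i) * (1 - of_real t) + \<mu> i)) = 1"
      using elim unfolding prod.distrib[symmetric]
      by (intro prod.neutral) (auto simp: gamma_factor_def rGamma_inverse_Gamma)
    show ?case
      using elim A P unfolding gamma_factor_def Q_def
      by (simp add: field_simps)
  qed
  ultimately have "((\<lambda>t::real. 1::complex) \<longlongrightarrow> 0) (at_left (0::real))"
    by (rule Lim_transform_eventually)
  thus False by (simp add: tendsto_const_iff)
qed

text \<open>Writing the denominator with \<open>rGamma\<close> makes the factor continuous across
  its poles, where \<open>rGamma\<close> vanishes; positive real parts keep the numerator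
  finite.\<close>

lemma tendsto_gamma_factor_zero:
  assumes "j \<in> {1..K}" "of_real (\<beta> j) * of_real t0 + \<omega> j \<in> \<int>\<^sub>\<le>\<^sub>0"
    and "\<And>i. i \<in> {1..k} \<Longrightarrow> Re (of_real (\<alpha> i) * (1 - of_real t0) + \<mu> i) > 0"
    and "A \<noteq> 0" "B \<noteq> 0"
  shows "((\<lambda>t. gamma_factor A B k \<alpha> \<mu> K \<beta> \<omega> (of_real t)) \<longlongrightarrow> 0) (at_left t0)"
proof -
  define Q where "Q = (\<lambda>s. A powr (1 - s) * (\<Prod>i=1..k. Gamma (of_real (\<alpha> i) * (1 - s) + \<mu> i)) *
      (inverse (B powr s) * (\<Prod>j=1..K. rGamma (of_real (\<beta> j) * s + \<omega> j))))"
  have eq: "gamma_factor A B k \<alpha> \<mu> K \<beta> \<omega> = Q"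
    by (simp add: fun_eq_iff gamma_factor_def Q_def rGamma_inverse_Gamma divide_inverse prod_inversef[symmetric])
  have "isCont Q (of_real t0)" unfolding Q_def
    using assms by (intro continuous_intros isCont_powr_const nonpos_Ints_not_Re_pos) auto
  moreover have "filterlim complex_of_real (nhds (of_real t0)) (at_left t0)"
    by (intro tendsto_intros)
  ultimately have "((\<lambda>t. Q (of_real t)) \<longlongrightarrow> Q (of_real t0)) (at_left t0)"
    by (rule isCont_tendsto_compose)
  moreover have "Q (of_real t0) = 0"
    using assms(1,2) by (auto simp: Q_def rGamma_eq_zero_iff)
  ultimately show ?thesis by (simp add: eq)
qed

section \<open>Blow-up of Hlawka series at 1\<close>

lemma hlawka_continuation_of_real:
  assumes "polar_function \<rho>" "hlawka_continuation \<rho> Z" "x > 1"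
  shows "Z (of_real x) = of_real (\<Sum>\<^sub>\<infinity>p\<in>nz_lattice. hlawka_term \<rho> x p)"
  using assms hlawka_zeta_of_real[OF assms(1,3)] by (simp add: hlawka_continuation_def)

lemma hlawka_sum_at_1:
  assumes "polar_function \<rho>"
  shows "filterlim (\<lambda>x. \<Sum>\<^sub>\<infinity>p\<in>nz_lattice. hlawka_term \<rho> x p) at_top (at_right 1)"
proof -
  obtain c where c: "0 < c" "c \<le> 1"
    "\<And>x. x > 1 \<Longrightarrow> (\<Sum>\<^sub>\<infinity>p\<in>nz_lattice. hlawka_term \<rho> x p) \<ge> c powr (2 * x) * 2 powr (-x) * (8 * real_zeta (2 * x - 1))"
    using hlawka_lower[OF assms] by metis
  have "filterlim (\<lambda>x. real_zeta (2 * x - 1)) at_top (at_right 1)"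
  proof (rule filterlim_compose[OF real_zeta_at_1])
    show "filterlim (\<lambda>x::real. 2 * x - 1) (at_right 1) (at_right 1)"
      by (auto simp: filterlim_at eventually_at_filter intro!: tendsto_eq_intros)
  qed
  moreover have lim: "((\<lambda>x. c powr (2 * x) * 2 powr (-x) * 8) \<longlongrightarrow> c powr (2 * 1) * 2 powr (-1) * 8) (at_right 1)"
    using c by (intro tendsto_intros) auto
  ultimately have "filterlim (\<lambda>x. c powr (2 * x) * 2 powr (-x) * 8 * real_zeta (2 * x - 1)) at_top (at_right 1)"
    using c by (intro filterlim_tendsto_pos_mult_at_top[OF lim]) auto
  moreover have "eventually (\<lambda>x. c powr (2 * x) * 2 powr (-x) * 8 * real_zeta (2 * x - 1) \<le> (\<Sum>\<^sub>\<infinity>p\<in>nz_lattice. hlawka_term \<rho> x p)) (at_right 1)"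
    using eventually_at_right_less[of "1::real"] by eventually_elim (use c(3) in \<open>simp add: mult_ac\<close>)
  ultimately show ?thesis by (rule filterlim_at_top_mono)
qed

section \<open>Contradiction from the functional equation\<close>

lemma square_no_functional_equation:
  fixes r r' :: "real \<Rightarrow> real"
  assumes r: "polar_function r"
    and sq: "range (\<lambda>\<theta>. (r \<theta> * cos \<theta>, r \<theta> * sin \<theta>)) = frontier ({-1..1} \<times> {-1..1})"
    and r': "polar_function r'"
    and \<alpha>: "\<And>i. i \<in> {1..k} \<Longrightarrow> \<alpha> i > 0" and \<beta>: "\<And>j. j \<in> {1..K} \<Longrightarrow> \<beta> j > 0"
    and Z: "hlawka_continuation r Z" and Z': "hlawka_continuation r' Z'"
    and eq: "\<forall>\<^sub>\<approx>s\<in>UNIV. Z s = gamma_factor A B k \<alpha> \<mu> K \<beta> \<omega> s * Z' (1 - s)"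
  shows False
proof -
  let ?G = "\<lambda>t. gamma_factor A B k \<alpha> \<mu> K \<beta> \<omega> (of_real t)"
  define H where "H = (\<lambda>x. \<Sum>\<^sub>\<infinity>p\<in>nz_lattice. hlawka_term r' x p)"
  define L where "L = (\<lambda>t. 8 * (zeta_factor (2 * t - 1) * real_zeta (2 - 2 * t)))"
  \<comment> \<open>Left limits at \<open>t0 \<le> 0\<close> avoid the isolated exceptional points
    and keep \<open>1 - t > 1\<close>, where \<open>Z'\<close> is given by its positive series
    \<open>H\<close>.\<close>
  have key: "eventually (\<lambda>t. t < t0 \<and> of_real (L t) = ?G t * of_real (H (1 - t))) (at_left t0)"
    if t0: "t0 \<le> 0" for t0
  proof -
    have "eventually (\<lambda>s. Z s = gamma_factor A B k \<alpha> \<mu> K \<beta> \<omega> s * Z' (1 - s)) (at (of_real t0))"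
      using eq by (simp add: eventually_cosparse_open_eq)
    hence "eventually (\<lambda>t. Z (of_real t) = ?G t * Z' (1 - of_real t)) (at t0)"
      by (rule eventually_at_of_real)
    moreover have "eventually (\<lambda>t. Z (of_real t) = of_real (L t)) (at t0)"
      unfolding L_def using t0 by (intro hlawka_square_left[OF r sq Z]) simp
    ultimately have "eventually (\<lambda>t. of_real (L t) = ?G t * Z' (1 - of_real t)) (at t0)"
      by eventually_elim simp
    hence "eventually (\<lambda>t. of_real (L t) = ?G t * Z' (1 - of_real t)) (at_left t0)"
      by (rule filter_leD[OF at_le, rotated]) simp
    moreover have "eventually (\<lambda>t. t < t0) (at_left t0)"
      by (simp add: eventually_at_filter)
    ultimately show ?thesis
    proof eventually_elim
      case (elim t)
      have "Z' (1 - of_real t) = of_real (H (1 - t))"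
        using hlawka_continuation_of_real[OF r' Z', of "1 - t"] elim t0 by (simp add: H_def)
      with elim show ?case by simp
    qed
  qed
  have zf: "((\<lambda>t. zeta_factor (2 * t - 1)) \<longlongrightarrow> zeta_factor (2 * t0 - 1)) (at_left t0)" if "t0 \<le> 0" for t0
    by (rule isCont_tendsto_compose[OF isCont_zeta_factor]) (use that in \<open>auto intro!: tendsto_intros\<close>)

  have nonzero: "eventually (\<lambda>t. ?G t \<noteq> 0) (at_left 0)"
  proof -
    have "zeta_factor (-1) \<noteq> 0"
      using less_imp_neq[OF Gamma_real_pos[of 2]] by (simp add: zeta_factor_def)
    with zf[of 0] have "eventually (\<lambda>t. zeta_factor (2 * t - 1) \<noteq> 0) (at_left 0)"
      by (intro tendsto_imp_eventually_ne) auto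
    with key[OF order_refl] show ?thesis
    proof eventually_elim
      case (elim t)
      have "L t \<noteq> 0" using elim real_zeta_pos[of "2 - 2 * t"] by (simp add: L_def)
      with elim show ?case by auto
    qed
  qed
  have H_top: "filterlim (\<lambda>t. H (1 - t)) at_top (at_left 0)"
  proof (rule filterlim_compose[of H at_top "at_right 1" "\<lambda>t. 1 - t"])
    show "filterlim H at_top (at_right 1)"
      unfolding H_def by (rule hlawka_sum_at_1[OF r'])
    show "filterlim (\<lambda>t::real. 1 - t) (at_right 1) (at_left 0)"
      by (auto simp: filterlim_at eventually_at_filter intro!: tendsto_eq_intros)
  qed
  have "(?G \<longlongrightarrow> 0) (at_left 0)"
  proof (rule Lim_null_comparison)
    \<comment> \<open>\<open>norm (?G t)\<close> is the quotient of \<open>\<bar>L t\<bar>\<close>,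
      bounded near 0, by \<open>H (1 - t)\<close>, which tends to infinity.\<close>
    show "eventually (\<lambda>t. norm (?G t) \<le> 8 * \<bar>zeta_factor (2 * t - 1)\<bar> * real_zeta 2 / H (1 - t)) (at_left 0)"
      using key[OF order_refl] H_top[unfolded filterlim_at_top_dense, rule_format, of 0]
    proof eventually_elim
      case (elim t)
      have "norm (complex_of_real (L t)) = norm (?G t * of_real (H (1 - t)))"
        using elim by (simp only:)
      hence "norm (?G t) * H (1 - t) = \<bar>L t\<bar>"
        using elim(2) by (simp add: norm_mult)
      also have "\<dots> = 8 * \<bar>zeta_factor (2 * t - 1)\<bar> * real_zeta (2 - 2 * t)"
        using elim real_zeta_pos[of "2 - 2 * t"] by (simp add: L_def abs_mult)
      also have "\<dots> \<le> 8 * \<bar>zeta_factor (2 * t - 1)\<bar> * real_zeta 2"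
        using elim by (intro mult_left_mono real_zeta_antimono) auto
      finally show ?case using elim by (simp add: field_simps)
    qed
    have "((\<lambda>t. 8 * \<bar>zeta_factor (2 * t - 1)\<bar> * real_zeta 2) \<longlongrightarrow>
       8 * \<bar>zeta_factor (2 * 0 - 1)\<bar> * real_zeta 2) (at_left 0)"
      by (intro tendsto_intros zf) simp
    thus "((\<lambda>t. 8 * \<bar>zeta_factor (2 * t - 1)\<bar> * real_zeta 2 / H (1 - t)) \<longlongrightarrow> 0) (at_left 0)"
      by (rule tendsto_divide_0[OF _ filterlim_at_top_imp_at_infinity[OF H_top]])
  qed
  with nonzero obtain j where j: "j \<in> {1..K}" "\<omega> j \<in> \<int>\<^sub>\<le>\<^sub>0"
    using gamma_factor_no_pole_imp_no_zero by blast
  from j(2) obtain n0 :: nat where n0: "\<omega> j = - of_nat n0" by (auto elim: nonpos_Ints_cases')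
  have \<beta>j: "\<beta> j > 0" using \<beta> j by blast
  obtain t where "?G t \<noteq> 0" using eventually_happens[OF nonzero] by auto
  hence AB: "A \<noteq> 0" "B \<noteq> 0" by (auto simp: gamma_factor_def)

  \<comment> \<open>At \<open>t0 = - m / \<beta> j\<close> the j-th denominator argument has moved
    from \<open>- n0\<close> to \<open>- (m + n0)\<close>, again a pole. The condition on
    \<open>m\<close> keeps the numerator arguments in the right half plane.\<close>
  have cos0: "cos (pi * (m / \<beta> j)) = 0"
    if m: "m \<ge> 1" "\<And>i. i \<in> {1..k} \<Longrightarrow> \<alpha> i * (1 + real m / \<beta> j) + Re (\<mu> i) > 0" for m :: nat
  proof -
    define t0 where "t0 = - (real m / \<beta> j)"
    have t0: "t0 < 0" using m \<beta>j by (simp add: t0_def)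
    have "(?G \<longlongrightarrow> 0) (at_left t0)"
    proof (rule tendsto_gamma_factor_zero[OF j(1)])
      have "of_real (\<beta> j) * of_real t0 + \<omega> j = - complex_of_nat (m + n0)"
        using \<beta>j by (simp add: t0_def n0)
      thus "of_real (\<beta> j) * of_real t0 + \<omega> j \<in> \<int>\<^sub>\<le>\<^sub>0"
        by (simp only: uminus_in_nonpos_Ints_iff of_nat_in_Nats)
    qed (use m AB in \<open>auto simp: t0_def\<close>)
    obtain C where C: "C \<ge> 1" "\<And>x. x > 1 \<Longrightarrow> H x \<le> C powr (2 * x) * (8 * real_zeta (2 * x - 1))"
      using hlawka_upper[OF r'] unfolding H_def by metis
    \<comment> \<open>A bound for \<open>H (1 - t)\<close> on \<open>t0 - 1 < t < t0\<close>: the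
      power is largest at the left end and the decreasing zeta at the right end.\<close>
    define M where "M = C powr (2 * (2 - t0)) * (8 * real_zeta (1 - 2 * t0))"
    have ev: "eventually (\<lambda>t. norm (zeta_factor (2 * t - 1)) \<le> norm (?G t) * M) (at_left t0)"
      using key[OF less_imp_le[OF t0]] eventually_at_left_real[of "t0 - 1" t0, simplified]
    proof eventually_elim
      case (elim t)
      hence t: "t0 - 1 < t" "t < t0" by auto
      have norm_eq: "norm (complex_of_real (L t)) = norm (?G t * of_real (H (1 - t)))"
        using elim by (simp only:)
      \<comment> \<open>Since zeta is at least 1 on the series side, a zero of the limit can only
        come from \<open>zeta_factor\<close>.\<close>
      have "\<bar>zeta_factor (2 * t - 1)\<bar> * 1 \<le> \<bar>zeta_factor (2 * t - 1)\<bar> * (8 * real_zeta (2 - 2 * t))"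
        using real_zeta_ge_1[of "2 - 2 * t"] t t0 by (intro mult_left_mono) auto
      also have "\<dots> = \<bar>L t\<bar>"
        using real_zeta_pos[of "2 - 2 * t"] t t0 by (simp add: L_def abs_mult)
      also have "\<dots> = norm (?G t) * \<bar>H (1 - t)\<bar>"
        using norm_eq by (simp add: norm_mult)
      also have "\<bar>H (1 - t)\<bar> = H (1 - t)"
        by (simp add: H_def infsum_nonneg hlawka_term_nonneg)
      also have "H (1 - t) \<le> C powr (2 * (1 - t)) * (8 * real_zeta (2 * (1 - t) - 1))"
        using t t0 by (intro C(2)) simp
      also have "\<dots> \<le> M"
        unfolding M_def using t t0 C(1) less_imp_le[OF real_zeta_pos[of "2 * (1 - t) - 1"]]
        by (intro mult_mono powr_mono mult_left_mono real_zeta_antimono) auto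
      finally show ?case by (simp add: mult_left_mono)
    qed
    have lim: "((\<lambda>t. norm (?G t) * M) \<longlongrightarrow> 0) (at_left t0)"
      using \<open>(?G \<longlongrightarrow> 0) (at_left t0)\<close> by (intro tendsto_mult_left_zero tendsto_norm_zero)
    have "((\<lambda>t. zeta_factor (2 * t - 1)) \<longlongrightarrow> 0) (at_left t0)"
      by (rule Lim_null_comparison[OF ev lim])
    with zf[of t0] t0 have "zeta_factor (2 * t0 - 1) = 0"
      by (intro tendsto_unique[of "at_left t0"]) auto
    moreover have "Gamma (1 - (2 * t0 - 1)) > 0" using t0 by (intro Gamma_real_pos) simp
    ultimately have "sin (pi * (2 * t0 - 1) / 2) = 0" by (simp add: zeta_factor_def)
    also have "pi * (2 * t0 - 1) / 2 = - (pi / 2 - pi * t0)" by (simp add: field_simps)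
    also have "sin (- (pi / 2 - pi * t0)) = - cos (pi * t0)"
      by (simp only: sin_minus) (simp add: sin_diff)
    finally show ?thesis by (simp add: t0_def)
  qed
  \<comment> \<open>The real parts grow linearly in \<open>m\<close> because each
    \<open>\<alpha> i / \<beta> j\<close> is positive.\<close>
  have "eventually (\<lambda>m. \<forall>i\<in>{1..k}. \<alpha> i * (1 + real m / \<beta> j) + Re (\<mu> i) > 0) sequentially"
  proof (rule eventually_ball_finite)
    show "\<forall>i\<in>{1..k}. eventually (\<lambda>m. \<alpha> i * (1 + real m / \<beta> j) + Re (\<mu> i) > 0) sequentially"
    proof
      fix i assume "i \<in> {1..k}"
      hence "\<alpha> i > 0" by (rule \<alpha>)
      hence "filterlim (\<lambda>m. (\<alpha> i + Re (\<mu> i)) + \<alpha> i / \<beta> j * real m) at_top sequentially"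
        using \<beta>j by (intro filterlim_tendsto_add_at_top[OF tendsto_const]
          filterlim_tendsto_pos_mult_at_top[OF tendsto_const _ filterlim_real_sequentially]) simp
      hence "filterlim (\<lambda>m. \<alpha> i * (1 + real m / \<beta> j) + Re (\<mu> i)) at_top sequentially"
        by (simp add: algebra_simps)
      thus "eventually (\<lambda>m. \<alpha> i * (1 + real m / \<beta> j) + Re (\<mu> i) > 0) sequentially"
        by (simp add: filterlim_at_top_dense)
    qed
  qed simp
  then obtain m where m: "\<And>m' i. m' \<ge> m \<Longrightarrow> i \<in> {1..k} \<Longrightarrow> \<alpha> i * (1 + real m' / \<beta> j) + Re (\<mu> i) > 0"
    unfolding eventually_sequentially by blast
  \<comment> \<open>The indices \<open>Suc m\<close> and \<open>2 * Suc m\<close> are both positive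
    and large enough for \<open>cos0\<close>, but a zero of \<open>cos x\<close> forces
    \<open>cos (2 * x) = -1\<close>.\<close>
  define x where "x = pi * (real (Suc m) / \<beta> j)"
  have "cos x = 0" unfolding x_def by (rule cos0[OF _ m]) auto
  moreover have "cos (2 * x) = 0"
  proof -
    have "2 * x = pi * (real (2 * Suc m) / \<beta> j)" by (simp add: x_def)
    thus ?thesis by (simp only:) (rule cos0[OF _ m], auto)
  qed
  ultimately show False by (simp add: cos_double_cos)
qed

theorem theorem36:
  fixes r :: "real \<Rightarrow> real"
  assumes "polar_function r"
    and "range (\<lambda>\<theta>. (r \<theta> * cos \<theta>, r \<theta> * sin \<theta>)) = frontier ({-1..1} \<times> {-1..1})"
  shows "\<not> (\<exists>(r' :: real \<Rightarrow> real) (k :: nat) (K :: nat)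
              (\<alpha> :: nat \<Rightarrow> real) (\<beta> :: nat \<Rightarrow> real) (A :: complex) (B :: complex)
              (\<mu> :: nat \<Rightarrow> complex) (\<omega> :: nat \<Rightarrow> complex)
              (Z :: complex \<Rightarrow> complex) (Z' :: complex \<Rightarrow> complex).
            polar_function r' \<and>
            (\<forall>i\<in>{1..k}. \<alpha> i > 0) \<and> (\<forall>j\<in>{1..K}. \<beta> j > 0) \<and>
            hlawka_continuation r Z \<and> hlawka_continuation r' Z' \<and>
            (\<forall>\<^sub>\<approx>s\<in>UNIV. Z s = gamma_factor A B k \<alpha> \<mu> K \<beta> \<omega> s * Z' (1 - s)))"
  using square_no_functional_equation[OF assms] by blast

end
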